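(* For every integer $u \equiv 1 \pmod{6}$, there exists an MK$(2u+1)$, i.e., a Kirkman triple system of order $2u+1$ that contains a Steiner triple system of order $u$ as a subdesign.
   Context: A Steiner triple system STS$(v)$ is a pair $(V,\mathcal{B})$ with $|V|=v$ and $\mathcal{B}$ a set of 3-subsets (blocks) of $V$ such that every pair of distinct points lies in exactly one block. A Kirkman triple system KTS$(v)$ is an STS$(v)$ whose blocks can be partitioned into parallel classes, each a partition of $V$. A subdesign of $(V,\mathcal{B})$ is a pair $(U,\mathcal{A})$ with $U\subseteq V$, $\mathcal{A}\subseteq\mathcal{B}$, and $(U,\mathcal{A})$ itself an STS. MK$(2u+1)$ denotes a KTS$(2u+1)$ containing an STS$(u)$ as a subdesign (the maximum possible size). *)

theory Defs
  imports "HOL-Library.Disjoint_Sets" "HOL-Number_Theory.Cong"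
begin

definition steiner_triple_system :: "nat \<Rightarrow> 'a set \<Rightarrow> 'a set set \<Rightarrow> bool" where
  "steiner_triple_system v V \<B> \<longleftrightarrow>
     finite V \<and> card V = v \<and>
     (\<forall>B\<in>\<B>. B \<subseteq> V \<and> card B = 3) \<and>
     (\<forall>x\<in>V. \<forall>y\<in>V. x \<noteq> y \<longrightarrow> (\<exists>!B. B \<in> \<B> \<and> x \<in> B \<and> y \<in> B))"

definition kirkman_triple_system :: "nat \<Rightarrow> 'a set \<Rightarrow> 'a set set \<Rightarrow> bool" where
  "kirkman_triple_system v V \<B> \<longleftrightarrow>
     steiner_triple_system v V \<B> \<and>
     (\<exists>\<R>. partition_on \<B> \<R> \<and> (\<forall>P\<in>\<R>. partition_on V P))"

definition subdesign :: "nat \<Rightarrow> 'a set \<Rightarrow> 'a set set \<Rightarrow> 'a set \<Rightarrow> 'a set set \<Rightarrow> bool" where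
  "subdesign u U \<A> V \<B> \<longleftrightarrow> U \<subseteq> V \<and> \<A> \<subseteq> \<B> \<and> steiner_triple_system u U \<A>"

text \<open>The first argument is the order \<open>u\<close> of the subdesign: \<open>MK u V \<B>\<close> says that
  \<open>(V, \<B>)\<close> is an MK\<open>(2u + 1)\<close>. The subdesign need not be resolvable.\<close>

definition MK :: "nat \<Rightarrow> 'a set \<Rightarrow> 'a set set \<Rightarrow> bool" where
  "MK u V \<B> \<longleftrightarrow>
     kirkman_triple_system (2 * u + 1) V \<B> \<and> (\<exists>U \<A>. subdesign u U \<A> V \<B>)"

end

(* Removing a point outside the subdesign from an MK(2u+1) leaves points (x, True) of the subdesign
   and (x, False) outside it, where (x, True), (x, False) and the removed point used to form a block;
   the parallel classes are then also labelled by x. The resulting "frame" makes sense over any graph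
   on the labels, an MK(2u+1) being a frame over the complete graph K_u, and frames over
   edge-disjoint graphs can be united. Write u = 6k+1. Truncating one group of a transversal design
   TD(5, m) to t points, giving every point weight 6 and adding one point decomposes K_u, for
   k = 4m+t, into copies of K_{6m+1}, K_{6t+1} and of the complete multipartite graphs of types
   6^4 and 6^5. By induction this leaves these two multipartite graphs and k <= 15, k = 26, k = 27,
   for which the frames were found by computer: cyclic ones given by starter blocks, except for
   type 6^4, where a parity obstruction excludes a cyclic frame and all blocks are listed. *)

theory Submission
  imports Defs "HOL-Library.Countable"
begin


text \<open>The parity obstruction for type 6^4: suppose a frame on Z_24, with the residue classes
  modulo 4 as groups, arose from class 0 by translation. Class 0 consists of 3 triples inside the
  subdesign and 9 blocks with one point \<open>(c, True)\<close> and two points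
  \<open>(x, False)\<close>, \<open>(y, False)\<close>. The differences \<open>c - x\<close> and
  \<open>c - y\<close> run once through the 18 residues not divisible by 4, and so do the labels
  \<open>x\<close> and \<open>y\<close>; both sums are 216, which is 0 modulo 24. Hence the sum S of
  the labels \<open>c\<close> satisfies 2S = 0 modulo 24, so 4 divides S. But each of the 3 triples
  has labels 1, 2, 3 modulo 4, so together they sum to 2 modulo 4, and S = 216 - 2 = 2 modulo 4.

  The orders treated directly come from the intervals [4m, 5m] that a TD(5, m) reaches. The numbers
  26 and 27 lie in such an interval only for m = 6, where not even two orthogonal Latin squares
  exist. Below 16 only m <= 3 could occur, and there is no TD(5, 2) and no TD(5, 3).\<close>

section \<open>Frames over a graph\<close>

text \<open>An element \<open>(c, B)\<close> of a frame is a block \<open>B\<close> in the class labelled \<open>c\<close>.\<close>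

definition frame :: "('a \<times> 'a) set \<Rightarrow> ('a \<times> ('a \<times> bool) set) set \<Rightarrow> bool" where
  "frame D F \<longleftrightarrow> irrefl D \<and>
     (\<forall>c B. (c, B) \<in> F \<longrightarrow> card B = 3 \<and> (\<forall>p\<in>B. (c, fst p) \<in> D) \<and>
        (\<forall>p\<in>B. \<forall>q\<in>B. p \<noteq> q \<longrightarrow> (fst p, fst q) \<in> D) \<and>
        (\<forall>p\<in>B. \<forall>q\<in>B. p \<noteq> q \<longrightarrow> snd p \<longrightarrow> snd q \<longrightarrow> (\<forall>r\<in>B. snd r))) \<and>
     (\<forall>x y s t. (x, y) \<in> D \<longrightarrow> (\<exists>!e. e \<in> F \<and> (x, s) \<in> snd e \<and> (y, t) \<in> snd e)) \<and>
     (\<forall>c x s. (c, x) \<in> D \<longrightarrow> (\<exists>!B. (c, B) \<in> F \<and> (x, s) \<in> B))"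

definition framed :: "('a \<times> 'a) set \<Rightarrow> bool" where
  "framed D \<longleftrightarrow> (\<exists>F. frame D F)"

definition multipartite :: "'a set \<Rightarrow> ('a \<Rightarrow> 'b) \<Rightarrow> ('a \<times> 'a) set" where
  "multipartite A g = {(x, y). x \<in> A \<and> y \<in> A \<and> g x \<noteq> g y}"

lemma
  assumes "frame D F" "(c, B) \<in> F"
  shows frame_card: "card B = 3"
    and frame_class_in: "p \<in> B \<Longrightarrow> (c, fst p) \<in> D"
    and frame_pair_in: "\<lbrakk>p \<in> B; q \<in> B; p \<noteq> q\<rbrakk> \<Longrightarrow> (fst p, fst q) \<in> D"
    and frame_closed: "\<lbrakk>p \<in> B; q \<in> B; r \<in> B; p \<noteq> q; snd p; snd q\<rbrakk> \<Longrightarrow> snd r"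
proof -
  note * = assms(1)[unfolded frame_def, THEN conjunct2, THEN conjunct1, rule_format, OF assms(2)]
  show "card B = 3" using * by (elim conjE)
  show "p \<in> B \<Longrightarrow> (c, fst p) \<in> D" using *[THEN conjunct2, THEN conjunct1] by (rule bspec)
  show "(fst p, fst q) \<in> D" if "p \<in> B" "q \<in> B" "p \<noteq> q"
    using *[THEN conjunct2, THEN conjunct2, THEN conjunct1] that by simp
  show "snd r" if "p \<in> B" "q \<in> B" "r \<in> B" "p \<noteq> q" "snd p" "snd q"
    using *[THEN conjunct2, THEN conjunct2, THEN conjunct2] that by metis
qed

lemma frame_irrefl: "frame D F \<Longrightarrow> (x, x) \<notin> D"
  by (simp add: frame_def irrefl_def)

lemma frame_pair_ex1:
  "\<lbrakk>frame D F; (x, y) \<in> D\<rbrakk> \<Longrightarrow> \<exists>!e. e \<in> F \<and> (x, s) \<in> snd e \<and> (y, t) \<in> snd e"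
  by (simp add: frame_def)

lemma frame_class_ex1:
  "\<lbrakk>frame D F; (c, x) \<in> D\<rbrakk> \<Longrightarrow> \<exists>!B. (c, B) \<in> F \<and> (x, s) \<in> B"
  by (simp add: frame_def)

text \<open>Each unique-existence condition of a frame belongs to a single edge: two points to the
  edge between their labels, a class and a point to the edge between class label and point label.
  Labelling the classes by the labels of the points is what makes resolvability local in this way. A
  block of \<open>F j\<close> has all its edges in \<open>D j\<close>, so disjointness of the graphs
  excludes a competing block from another frame.\<close>

lemma framed_UN:
  assumes fr: "\<And>i. i \<in> I \<Longrightarrow> framed (D i)" and disj: "disjoint_family_on D I"
  shows "framed (\<Union>i\<in>I. D i)"
proof -
  obtain F where F: "\<And>i. i \<in> I \<Longrightarrow> frame (D i) (F i)"
    using fr unfolding framed_def by metis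
  have same: "i = j" if "i \<in> I" "j \<in> I" "z \<in> D i" "z \<in> D j" for i j z
    using disj that unfolding disjoint_family_on_def by blast
  have "frame (\<Union>i\<in>I. D i) (\<Union>i\<in>I. F i)"
    unfolding frame_def
  proof (intro conjI allI impI, goal_cases)
    case 1
    show ?case using frame_irrefl[OF F] by (auto simp: irrefl_def)
  next
    case (2 c B)
    then obtain i where "i \<in> I" "(c, B) \<in> F i" by blast
    then show ?case using frame_card[OF F] by blast
  next
    case (3 c B)
    then obtain i where "i \<in> I" "(c, B) \<in> F i" by blast
    then show ?case using frame_class_in[OF F] by blast
  next
    case (4 c B)
    then obtain i where "i \<in> I" "(c, B) \<in> F i" by blast
    then show ?case using frame_pair_in[OF F] by blast
  next
    case (5 c B)
    then obtain i where "i \<in> I" "(c, B) \<in> F i" by blast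
    then show ?case using frame_closed[OF F] by blast
  next
    case (6 x y s t)
    then obtain i where i: "i \<in> I" "(x, y) \<in> D i" by blast
    obtain e where e: "e \<in> F i" "(x, s) \<in> snd e" "(y, t) \<in> snd e"
      and uni: "\<And>e'. \<lbrakk>e' \<in> F i; (x, s) \<in> snd e'; (y, t) \<in> snd e'\<rbrakk> \<Longrightarrow> e' = e"
      using frame_pair_ex1[OF F[OF i(1)] i(2), of s t] by blast
    show ?case
    proof (rule ex1I[of _ e])
      fix e' assume e': "e' \<in> (\<Union>i\<in>I. F i) \<and> (x, s) \<in> snd e' \<and> (y, t) \<in> snd e'"
      then obtain j where j: "j \<in> I" "e' \<in> F j" by blast
      have "x \<noteq> y"
        using i(2) frame_irrefl[OF F[OF i(1)]] by auto
      then have "(x, y) \<in> D j"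
        using frame_pair_in[OF F[OF j(1)], of "fst e'" "snd e'" "(x, s)" "(y, t)"] e' j by auto
      then have "j = i" using same i j by blast
      then show "e' = e" using uni e' j by blast
    qed (use e i in blast)
  next
    case (7 c x s)
    then obtain i where i: "i \<in> I" "(c, x) \<in> D i" by blast
    obtain B where B: "(c, B) \<in> F i" "(x, s) \<in> B"
      and uni: "\<And>B'. \<lbrakk>(c, B') \<in> F i; (x, s) \<in> B'\<rbrakk> \<Longrightarrow> B' = B"
      using frame_class_ex1[OF F[OF i(1)] i(2), of s] by blast
    show ?case
    proof (rule ex1I[of _ B])
      fix B' assume B': "(c, B') \<in> (\<Union>i\<in>I. F i) \<and> (x, s) \<in> B'"
      then obtain j where j: "j \<in> I" "(c, B') \<in> F j" by blast
      then have "(c, x) \<in> D j"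
        using frame_class_in[OF F[OF j(1)], of c B' "(x, s)"] B' by auto
      then have "j = i" using same i j by blast
      then show "B' = B" using uni B' j by blast
    qed (use B i in blast)
  qed
  then show ?thesis unfolding framed_def by blast
qed

text \<open>Only equality of groups matters, not their names, so \<open>g\<close> and
  \<open>h\<close> are compared by the partitions that they induce. The map \<open>\<phi>\<close>
  relabels a point and keeps its side of the subdesign.\<close>

lemma framed_image:
  assumes fr: "framed (multipartite A g)" and bij: "bij_betw f A B"
    and gh: "\<And>x y. \<lbrakk>x \<in> A; y \<in> A\<rbrakk> \<Longrightarrow> g x = g y \<longleftrightarrow> h (f x) = h (f y)"
  shows "framed (multipartite B h)"
proof -
  obtain F where F: "frame (multipartite A g) F" using fr unfolding framed_def by blast
  define \<phi> where "\<phi> = map_prod f (id :: bool \<Rightarrow> bool)"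
  let ?D = "multipartite A g" and ?E = "multipartite B h"
  let ?G = "(\<lambda>(c, K). (f c, \<phi> ` K)) ` {(c, K) \<in> F. K \<noteq> {}}"
  have inj: "inj_on f A" and img: "f ` A = B" using bij by (auto simp: bij_betw_def)
  have eq: "x = y" if "f x = f y" "x \<in> A" "y \<in> A" for x y
    using inj that by (auto dest: inj_onD)
  have sub: "c \<in> A" "K \<subseteq> A \<times> UNIV" if "(c, K) \<in> F" for c K
    using frame_card[OF F that] frame_class_in[OF F that] unfolding multipartite_def by (force simp: card_3_iff)+
  have DE: "(f x, f y) \<in> ?E" if "(x, y) \<in> ?D" for x y
    using that gh img unfolding multipartite_def by auto
  have ED: "\<exists>x' y'. x = f x' \<and> y = f y' \<and> (x', y') \<in> ?D" if "(x, y) \<in> ?E" for x y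
  proof -
    from that img obtain x' y' where "x' \<in> A" "y' \<in> A" "x = f x'" "y = f y'"
      unfolding multipartite_def by blast
    then show ?thesis using that gh unfolding multipartite_def by blast
  qed
  have mem: "(f x, s) \<in> \<phi> ` K \<longleftrightarrow> (x, s) \<in> K" if "x \<in> A" "K \<subseteq> A \<times> UNIV" for x s K
    using that eq unfolding \<phi>_def by (force simp: image_iff)
  have injphi: "inj_on \<phi> (A \<times> UNIV)"
    unfolding \<phi>_def using inj by (auto simp: inj_on_def)
  have "frame ?E ?G"
    unfolding frame_def
  proof (intro conjI allI impI, goal_cases)
    case 1
    then show ?case unfolding irrefl_def multipartite_def by auto
  next
    case (2 c B)
    then obtain K c0 where "(c0, K) \<in> F" "B = \<phi> ` K" by auto
    then show ?case
      using frame_card[OF F] sub(2) injphi by (metis card_image inj_on_subset)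
  next
    case (3 c B)
    then obtain K c0 where "(c0, K) \<in> F" "B = \<phi> ` K" "c = f c0" by auto
    then show ?case using frame_class_in[OF F] DE by (auto simp: \<phi>_def)
  next
    case (4 c B)
    then obtain K c0 where K: "(c0, K) \<in> F" "B = \<phi> ` K" "c = f c0" by auto
    show ?case
    proof (intro ballI impI)
      fix p q assume p: "p \<in> B" "q \<in> B" "p \<noteq> q"
      then obtain p' q' where p': "p' \<in> K" "q' \<in> K" "p = \<phi> p'" "q = \<phi> q'"
        using K by auto
      then have "p' \<noteq> q'" using p by auto
      then show "(fst p, fst q) \<in> ?E" using frame_pair_in[OF F K(1) p'(1,2)] DE p' by (auto simp: \<phi>_def)
    qed
  next
    case (5 c B)
    then obtain K c0 where K: "(c0, K) \<in> F" "B = \<phi> ` K" "c = f c0" by auto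
    show ?case
    proof (intro ballI impI)
      fix p q r assume p: "p \<in> B" "q \<in> B" "p \<noteq> q" "snd p" "snd q" "r \<in> B"
      then obtain p' q' r' where p': "p' \<in> K" "q' \<in> K" "r' \<in> K" "p = \<phi> p'" "q = \<phi> q'" "r = \<phi> r'"
        using K by auto
      then have "p' \<noteq> q'" using p by auto
      then show "snd r" using frame_closed[OF F K(1) p'(1,2,3)] p p' by (auto simp: \<phi>_def)
    qed
  next
    case (6 x y s t)
    then obtain x' y' where x': "x = f x'" "y = f y'" "(x', y') \<in> ?D" using ED by blast
    then have A: "x' \<in> A" "y' \<in> A" unfolding multipartite_def by auto
    obtain c K where e: "(c, K) \<in> F" "(x', s) \<in> K" "(y', t) \<in> K"
      and uni: "\<And>e'. \<lbrakk>e' \<in> F; (x', s) \<in> snd e'; (y', t) \<in> snd e'\<rbrakk> \<Longrightarrow> e' = (c, K)"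
      using frame_pair_ex1[OF F x'(3), of s t] by (metis prod.collapse)
    show ?case
    proof (rule ex1I[of _ "(f c, \<phi> ` K)"])
      show "(f c, \<phi> ` K) \<in> ?G \<and> (x, s) \<in> snd (f c, \<phi> ` K) \<and> (y, t) \<in> snd (f c, \<phi> ` K)"
        using e x' mem[OF _ sub(2)[OF e(1)]] A by force
      fix e' assume e': "e' \<in> ?G \<and> (x, s) \<in> snd e' \<and> (y, t) \<in> snd e'"
      then obtain c' K' where c': "(c', K') \<in> F" "e' = (f c', \<phi> ` K')" by auto
      then have "(x', s) \<in> K'" "(y', t) \<in> K'" using e' x' mem[OF _ sub(2)[OF c'(1)]] A by auto
      then show "e' = (f c, \<phi> ` K)" using uni[OF c'(1)] c' by auto
    qed
  next
    case (7 c x s)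
    then obtain c' x' where x': "c = f c'" "x = f x'" "(c', x') \<in> ?D" using ED by blast
    then have A: "c' \<in> A" "x' \<in> A" unfolding multipartite_def by auto
    obtain K where e: "(c', K) \<in> F" "(x', s) \<in> K"
      and uni: "\<And>K'. \<lbrakk>(c', K') \<in> F; (x', s) \<in> K'\<rbrakk> \<Longrightarrow> K' = K"
      using frame_class_ex1[OF F x'(3), of s] by blast
    show ?case
    proof (rule ex1I[of _ "\<phi> ` K"])
      show "(c, \<phi> ` K) \<in> ?G \<and> (x, s) \<in> \<phi> ` K"
        using e x' mem[OF _ sub(2)[OF e(1)]] A by force
      fix B' assume B': "(c, B') \<in> ?G \<and> (x, s) \<in> B'"
      then obtain c0 K' where c0: "(c0, K') \<in> F" "c = f c0" "B' = \<phi> ` K'" by auto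
      then have "c0 = c'" using eq x' A sub(1)[OF c0(1)] by auto
      moreover have "(x', s) \<in> K'" using B' c0 x' mem[OF _ sub(2)[OF c0(1)]] A by auto
      ultimately show "B' = \<phi> ` K" using uni c0 by blast
    qed
  qed
  then show ?thesis unfolding framed_def by blast
qed

section \<open>Frames from starters and from explicit lists\<close>

text \<open>The block stays attached to its point, because the uniqueness to be derived is that of
  the block: equal keys must force equal blocks, not only equal points.\<close>

definition class_entries :: "(int \<times> bool) list list \<Rightarrow> bool \<Rightarrow> ((int \<times> bool) list \<times> int \<times> bool) list" where
  "class_entries bs s = [(b, p). b \<leftarrow> bs, p \<leftarrow> b, snd p = s]"

definition diff_entries ::
  "(int \<times> bool) list list \<Rightarrow> bool \<Rightarrow> bool \<Rightarrow> ((int \<times> bool) list \<times> (int \<times> bool) \<times> (int \<times> bool)) list" where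
  "diff_entries bs s t = [(b, p, q). b \<leftarrow> bs, p \<leftarrow> b, q \<leftarrow> b, p \<noteq> q, snd p = s, snd q = t]"

text \<open>These are the differences between different cosets of hZ in Z_n, the groups of a cyclic
  frame. For \<open>h = n\<close> the groups are single labels and the graph is complete.\<close>

definition residues_off :: "int \<Rightarrow> int \<Rightarrow> int list" where
  "residues_off n h = filter (\<lambda>d. d mod h \<noteq> 0) [0..n - 1]"

text \<open>In a system of order 2u + 1, a point outside a subdesign of order u lies on u blocks and
  meets the u points of the subdesign in different blocks. So every block through it has exactly one
  point of the subdesign, which leaves these two shapes.\<close>

definition block_shape :: "('a \<times> bool) list \<Rightarrow> bool" where
  "block_shape b \<longleftrightarrow> distinct b \<and> map snd b \<in> {[True, True, True], [True, False, False]}"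

text \<open>The blocks in \<open>bs\<close> form class \<open>0\<close>, and translation by \<open>g\<close> modulo \<open>n\<close> takes them to
  class \<open>g\<close>. Differences of type \<open>(False, True)\<close> are the negatives of those of type
  \<open>(True, False)\<close>.\<close>

definition starter :: "int \<Rightarrow> int \<Rightarrow> (int \<times> bool) list list \<Rightarrow> bool" where
  "starter n h bs \<longleftrightarrow> 0 < n \<and> h dvd n \<and> list_all block_shape bs \<and>
     (let R = residues_off n h in
       list_all (\<lambda>s. sort (map (\<lambda>(b, p). fst p) (class_entries bs s)) = R) [True, False] \<and>
       list_all (\<lambda>(s, t). sort (map (\<lambda>(b, p, q). (fst p - fst q) mod n) (diff_entries bs s t)) = R)
         [(True, True), (False, False), (True, False)])"

text \<open>Comparing sorted keys with a duplicate-free list compares multisets. One evaluation of a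
  list equation thus yields existence and uniqueness together.\<close>

lemma ex1_if_sort_map_eq:
  assumes "sort (map f xs) = ys" "distinct ys" "y \<in> set ys"
  shows "\<exists>!x. x \<in> set xs \<and> f x = y"
proof -
  have "distinct (map f xs)" using assms(1,2) by (metis distinct_sort)
  then have inj: "inj_on f (set xs)" by (simp add: distinct_map)
  have "y \<in> f ` set xs" using assms(1,3) by (metis list.set_map set_sort)
  then show ?thesis using inj by (auto dest: inj_onD)
qed

lemma block_shapeD:
  assumes "block_shape b"
  shows "card (set b) = 3"
    and "\<lbrakk>p \<in> set b; q \<in> set b; r \<in> set b; p \<noteq> q; snd p; snd q\<rbrakk> \<Longrightarrow> snd r"
proof -
  have len: "length b = 3" using assms unfolding block_shape_def by (auto dest: arg_cong[where f = length])
  then show "card (set b) = 3" using assms unfolding block_shape_def by (simp add: distinct_card)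
  from len obtain x y z where "b = [x, y, z]" by (auto simp: numeral_3_eq_3 length_Suc_conv)
  then show "snd r" if "p \<in> set b" "q \<in> set b" "r \<in> set b" "p \<noteq> q" "snd p" "snd q"
    using assms that unfolding block_shape_def by auto
qed

lemma set_class_entries:
  "(b, p) \<in> set (class_entries bs s) \<longleftrightarrow> b \<in> set bs \<and> p \<in> set b \<and> snd p = s"
  by (auto simp: class_entries_def)

lemma set_diff_entries:
  "(b, p, q) \<in> set (diff_entries bs s t) \<longleftrightarrow>
     b \<in> set bs \<and> p \<in> set b \<and> q \<in> set b \<and> p \<noteq> q \<and> snd p = s \<and> snd q = t"
  by (auto simp: diff_entries_def)

lemma ex1_keyE:
  assumes "\<exists>!z. z \<in> S \<and> (\<lambda>(b, p). k b p) z = d"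
  obtains b p where "(b, p) \<in> S" "k b p = d"
    "\<And>b' p'. \<lbrakk>(b', p') \<in> S; k b' p' = d\<rbrakk> \<Longrightarrow> b' = b \<and> p' = p"
proof -
  from assms obtain z where z: "z \<in> S \<and> (\<lambda>(b, p). k b p) z = d"
    and uni: "\<forall>z'. z' \<in> S \<and> (\<lambda>(b, p). k b p) z' = d \<longrightarrow> z' = z" by (rule ex1E)
  obtain b p where zb: "z = (b, p)" by (cases z)
  show thesis
  proof (rule that[of b p])
    show "(b, p) \<in> S" "k b p = d" using z zb by simp_all
    show "b' = b \<and> p' = p" if "(b', p') \<in> S" "k b' p' = d" for b' p'
      using uni[rule_format, of "(b', p')"] that zb by simp
  qed
qed

lemma ex1_tripleE:
  assumes "\<exists>!z. z \<in> S \<and> (\<lambda>(b, p, q). k p q) z = d"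
  obtains b p q where "(b, p, q) \<in> S" "k p q = d"
    "\<And>b' p' q'. \<lbrakk>(b', p', q') \<in> S; k p' q' = d\<rbrakk> \<Longrightarrow> b' = b \<and> p' = p \<and> q' = q"
proof -
  from assms obtain z where z: "z \<in> S \<and> (\<lambda>(b, p, q). k p q) z = d"
    and uni: "\<forall>z'. z' \<in> S \<and> (\<lambda>(b, p, q). k p q) z' = d \<longrightarrow> z' = z" by (rule ex1E)
  obtain b p q where zb: "z = (b, p, q)" by (cases z)
  show thesis
  proof (rule that[of b p q])
    show "(b, p, q) \<in> S" "k p q = d" using z zb by simp_all
    show "b' = b \<and> p' = p \<and> q' = q" if "(b', p', q') \<in> S" "k p' q' = d" for b' p' q'
      using uni[rule_format, of "(b', p', q')"] that zb by simp
  qed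
qed

text \<open>Translation preserves differences. So \<open>x - y\<close> selects an ordered pair of
  points in one base block, and \<open>x\<close> then fixes the translation. Within class
  \<open>c\<close> the translation is known, and \<open>x - c\<close> selects the base
  point.\<close>

lemma framed_if_starter:
  assumes "starter n h bs"
  shows "framed (multipartite {0..<n} (\<lambda>x. x mod h))"
proof -
  let ?R = "set (residues_off n h)"
  have n: "0 < n" and hn: "h dvd n" and shape: "\<And>b. b \<in> set bs \<Longrightarrow> block_shape b"
    using assms by (auto simp: starter_def list_all_iff)
  have cls_sort: "sort (map (\<lambda>(b, p). fst p) (class_entries bs s)) = residues_off n h" for s
    using assms by (cases s) (auto simp: starter_def Let_def)
  have diff_sort: "sort (map (\<lambda>(b, p, q). (fst p - fst q) mod n) (diff_entries bs s t)) = residues_off n h"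
    if "s \<or> \<not> t" for s t
    using assms that by (cases s; cases t) (auto simp: starter_def Let_def)
  have distR: "distinct (residues_off n h)" by (simp add: residues_off_def)
  have R: "d \<in> ?R \<longleftrightarrow> 0 \<le> d \<and> d < n \<and> \<not> h dvd d" for d
    by (auto simp: residues_off_def dvd_eq_mod_eq_0)
  have mod_h: "x mod n mod h = x mod h" for x using hn by (simp add: mod_mod_cancel)
  have cls: "\<exists>!z. z \<in> set (class_entries bs s) \<and> (\<lambda>(b, p). fst p) z = x" if "x \<in> ?R" for x s
    by (rule ex1_if_sort_map_eq[OF cls_sort distR that])
  have dif0: "\<exists>!z. z \<in> set (diff_entries bs s t) \<and> (\<lambda>(b, p, q). (fst p - fst q) mod n) z = d"
    if "d \<in> ?R" "s \<or> \<not> t" for d s t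
    by (rule ex1_if_sort_map_eq[OF diff_sort[OF that(2)] distR that(1)])
  have cls_R: "fst p \<in> ?R" if "b \<in> set bs" "p \<in> set b" for b p
  proof -
    have "(b, p) \<in> set (class_entries bs (snd p))" using that by (simp add: set_class_entries)
    then have "fst p \<in> (\<lambda>(b, p). fst p) ` set (class_entries bs (snd p))" by force
    also have "\<dots> = ?R" using arg_cong[OF cls_sort, of set] by simp
    finally show ?thesis .
  qed
  \<comment> \<open>The multiples of \<open>h\<close> are closed under negation modulo
    \<open>n\<close> because \<open>h\<close> divides \<open>n\<close>. This lets differences of
    type (False, True) be read backwards from those of type (True, False).\<close>
  have neg: "(- d) mod n \<in> ?R \<longleftrightarrow> d mod n \<in> ?R" for d
  proof -
    have "h dvd (- d) mod n \<longleftrightarrow> h dvd d mod n"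
      using hn by (simp add: dvd_mod_iff)
    then show ?thesis using n by (simp add: R)
  qed
  have diff_R: "(fst p - fst q) mod n \<in> ?R" if "b \<in> set bs" "p \<in> set b" "q \<in> set b" "p \<noteq> q" for b p q
  proof -
    have *: "(fst p - fst q) mod n \<in> ?R"
      if "p \<in> set b" "q \<in> set b" "p \<noteq> q" "snd p \<or> \<not> snd q" for p q
    proof -
      have "(b, p, q) \<in> set (diff_entries bs (snd p) (snd q))"
        using that \<open>b \<in> set bs\<close> by (simp add: set_diff_entries)
      then have "(fst p - fst q) mod n \<in> (\<lambda>(b, p, q). (fst p - fst q) mod n) ` set (diff_entries bs (snd p) (snd q))"
        by force
      also have "\<dots> = ?R" using arg_cong[OF diff_sort[OF that(4)], of set] by simp
      finally show ?thesis .
    qed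
    show ?thesis
    proof (cases "snd p \<or> \<not> snd q")
      case False
      then show ?thesis using *[of q p] that neg[of "fst q - fst p"] by simp
    qed (use * that in blast)
  qed
  have dif: "\<exists>b p q. (b, p, q) \<in> set (diff_entries bs s t) \<and> (fst p - fst q) mod n = d \<and>
      (\<forall>b' p' q'. (b', p', q') \<in> set (diff_entries bs s t) \<and> (fst p' - fst q') mod n = d \<longrightarrow>
        b' = b \<and> p' = p \<and> q' = q)"
    if d: "d \<in> ?R" for d s t
  proof (cases "s \<or> \<not> t")
    case True
    show ?thesis by (rule ex1_tripleE[OF dif0[OF d True]]) blast
  next
    case False
    have swap: "(fst p - fst q) mod n = d \<longleftrightarrow> (fst q - fst p) mod n = (- d) mod n" for p q :: "int \<times> bool"
    proof -
      have "d = d mod n" using d by (simp add: R)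
      then have "(fst p - fst q) mod n = d \<longleftrightarrow> n dvd (fst p - fst q) - d"
        by (metis mod_eq_dvd_iff)
      also have "\<dots> \<longleftrightarrow> n dvd (fst q - fst p) - (- d)"
        using dvd_minus_iff[of n "fst p - fst q - d"] by (simp add: algebra_simps)
      finally show ?thesis by (simp add: mod_eq_dvd_iff)
    qed
    have "(- d) mod n \<in> ?R" using d neg[of d] by (simp add: R)
    moreover have "t \<or> \<not> s" using False by simp
    ultimately obtain b p q where
      b: "(b, p, q) \<in> set (diff_entries bs t s)" "(fst p - fst q) mod n = (- d) mod n"
      and uni: "\<And>b' p' q'. \<lbrakk>(b', p', q') \<in> set (diff_entries bs t s); (fst p' - fst q') mod n = (- d) mod n\<rbrakk>
        \<Longrightarrow> b' = b \<and> p' = p \<and> q' = q"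
      by (rule ex1_tripleE[OF dif0]) (rule that)
    have "(b, q, p) \<in> set (diff_entries bs s t)" "(fst q - fst p) mod n = d"
      using b by (auto simp: set_diff_entries swap)
    moreover have "b' = b \<and> p' = q \<and> q' = p"
      if "(b', p', q') \<in> set (diff_entries bs s t)" "(fst p' - fst q') mod n = d" for b' p' q'
      using uni[of b' q' p'] that by (auto simp: set_diff_entries swap)
    ultimately show ?thesis by blast
  qed
  define \<tau> where "\<tau> g = map_prod (\<lambda>x. (x + g) mod n) (id :: bool \<Rightarrow> bool)" for g
  let ?D = "multipartite {0..<n} (\<lambda>x. x mod h)"
  let ?F = "{(g, \<tau> g ` set b) |g b. g \<in> {0..<n} \<and> b \<in> set bs}"
  have D: "(x, y) \<in> ?D \<longleftrightarrow> x \<in> {0..<n} \<and> y \<in> {0..<n} \<and> \<not> h dvd x - y" for x y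
    by (auto simp: multipartite_def mod_eq_dvd_iff)
  have shift_D: "((x + g) mod n, (y + g) mod n) \<in> ?D \<longleftrightarrow> (x - y) mod n \<in> ?R" for x y g
  proof -
    have "(x + g) mod n mod h = (y + g) mod n mod h \<longleftrightarrow> h dvd x - y"
      unfolding mod_h by (simp add: mod_eq_dvd_iff)
    then show ?thesis using n hn by (simp add: multipartite_def R dvd_mod_iff)
  qed
  have shift_inj: "x = y" if "(x + g) mod n = (y + g) mod n" "x \<in> {0..<n}" "y \<in> {0..<n}" for x y g
  proof -
    have "x mod n = y mod n" using that(1) by (simp add: mod_eq_dvd_iff)
    then show ?thesis using that(2,3) by simp
  qed
  have unshift: "g = (x - a) mod n" if "x = (a + g) mod n" "g \<in> {0..<n}" for x a g
    using that by (simp add: mod_diff_left_eq)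
  have reshift: "(a + (x - a) mod n) mod n = x" if "x \<in> {0..<n}" for x a
    using that by (simp add: mod_add_right_eq)
  have in_range: "fst p \<in> {0..<n}" if "b \<in> set bs" "p \<in> set b" for b p
    using cls_R[OF that] by (auto simp: R)
  have inj: "inj_on (\<tau> g) (set b)" if "b \<in> set bs" for g b
  proof (rule inj_onI)
    fix p q assume pq: "p \<in> set b" "q \<in> set b" "\<tau> g p = \<tau> g q"
    then have "(fst p + g) mod n = (fst q + g) mod n" "snd p = snd q"
      by (simp_all add: \<tau>_def prod_eq_iff)
    then show "p = q"
      using shift_inj[of "fst p" g "fst q"] in_range[OF that] pq by (simp add: prod_eq_iff)
  qed
  have "frame ?D ?F"
    unfolding frame_def
  proof (intro conjI allI impI, goal_cases)
    case 1
    then show ?case by (auto simp: irrefl_def multipartite_def)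
  next
    case (2 c B)
    then obtain b where "b \<in> set bs" "B = \<tau> c ` set b" by auto
    then show ?case using block_shapeD(1)[OF shape] inj card_image by metis
  next
    case (3 c B)
    then obtain b where b: "b \<in> set bs" "B = \<tau> c ` set b" "c \<in> {0..<n}" by auto
    \<comment> \<open>The class label \<open>c\<close> is the translate of 0, so the edge from class
      to point is the translate by \<open>c\<close> of the edge from 0 to
      \<open>fst p\<close>.\<close>
    have "(c, (fst p + c) mod n) \<in> ?D" if "p \<in> set b" for p
    proof -
      have "(0 - fst p) mod n \<in> ?R" using neg[of "fst p"] cls_R[OF b(1) that] by (simp add: R)
      then show ?thesis using shift_D[of 0 c "fst p"] b(3) by simp
    qed
    then show ?case using b by (auto simp: \<tau>_def)
  next
    case (4 c B)
    then obtain b where b: "b \<in> set bs" "B = \<tau> c ` set b" by auto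
    show ?case
    proof (intro ballI impI)
      fix p q assume p: "p \<in> B" "q \<in> B" "p \<noteq> q"
      then obtain p' q' where p': "p' \<in> set b" "q' \<in> set b" "p = \<tau> c p'" "q = \<tau> c q'"
        using b by auto
      then have "p' \<noteq> q'" using p by auto
      then show "(fst p, fst q) \<in> ?D"
        using diff_R[OF b(1) p'(1,2)] p' by (simp add: \<tau>_def shift_D)
    qed
  next
    case (5 c B)
    then obtain b where b: "b \<in> set bs" "B = \<tau> c ` set b" by auto
    show ?case
    proof (intro ballI impI)
      fix p q r assume p: "p \<in> B" "q \<in> B" "p \<noteq> q" "snd p" "snd q" "r \<in> B"
      then obtain p' q' r' where p': "p' \<in> set b" "q' \<in> set b" "r' \<in> set b"
          "p = \<tau> c p'" "q = \<tau> c q'" "r = \<tau> c r'"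
        using b by auto
      then have "p' \<noteq> q'" using p by auto
      then show "snd r" using block_shapeD(2)[OF shape[OF b(1)] p'(1,2,3)] p p' by (simp add: \<tau>_def)
    qed
  next
    case (6 x y s t)
    then have xy: "x \<in> {0..<n}" "y \<in> {0..<n}" "\<not> h dvd x - y" by (simp_all add: D)
    then have "(x - y) mod n \<in> ?R" using n hn by (simp add: R dvd_mod_iff)
    from dif[OF this, of s t] obtain b p q where
      b: "(b, p, q) \<in> set (diff_entries bs s t)" "(fst p - fst q) mod n = (x - y) mod n"
      and uni: "\<And>b' p' q'. \<lbrakk>(b', p', q') \<in> set (diff_entries bs s t); (fst p' - fst q') mod n = (x - y) mod n\<rbrakk>
        \<Longrightarrow> b' = b \<and> p' = p \<and> q' = q"
      by blast
    \<comment> \<open>The only translation taking \<open>fst p\<close> to \<open>x\<close>; as the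
      differences agree, it takes \<open>fst q\<close> to \<open>y\<close>.\<close>
    define g where "g = (x - fst p) mod n"
    have g: "g \<in> {0..<n}" using n by (simp add: g_def)
    have x: "(fst p + g) mod n = x" using reshift[OF xy(1)] by (simp add: g_def)
    have "(fst q + g) mod n = (fst q + (x - fst p)) mod n" by (simp add: g_def mod_add_right_eq)
    also have "\<dots> = y mod n"
    proof -
      have "n dvd (fst p - fst q) - (x - y)" using b(2) by (simp add: mod_eq_dvd_iff)
      then have "n dvd - ((fst p - fst q) - (x - y))" by (simp only: dvd_minus_iff)
      then show ?thesis by (simp add: mod_eq_dvd_iff algebra_simps)
    qed
    finally have y: "(fst q + g) mod n = y" using xy(2) by simp
    show ?case
    proof (rule ex1I[of _ "(g, \<tau> g ` set b)"])
      have "(x, s) = \<tau> g p" "(y, t) = \<tau> g q"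
        using b(1) x y by (auto simp: \<tau>_def set_diff_entries prod_eq_iff)
      then show "(g, \<tau> g ` set b) \<in> ?F \<and> (x, s) \<in> snd (g, \<tau> g ` set b) \<and> (y, t) \<in> snd (g, \<tau> g ` set b)"
        using b(1) g by (auto simp: set_diff_entries)
      fix e assume e: "e \<in> ?F \<and> (x, s) \<in> snd e \<and> (y, t) \<in> snd e"
      then obtain g' b' p' q' where e': "e = (g', \<tau> g' ` set b')" "g' \<in> {0..<n}" "b' \<in> set bs"
          "p' \<in> set b'" "q' \<in> set b'" "(x, s) = \<tau> g' p'" "(y, t) = \<tau> g' q'" by auto
      then have x': "x = (fst p' + g') mod n" "y = (fst q' + g') mod n" "snd p' = s" "snd q' = t"
        by (auto simp: \<tau>_def prod_eq_iff)
      have "x \<noteq> y" using xy by auto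
      then have "(b', p', q') \<in> set (diff_entries bs s t)"
        using e' x' by (auto simp: set_diff_entries)
      moreover have "(fst p' - fst q') mod n = (x - y) mod n"
        unfolding x' by (simp add: mod_diff_eq)
      ultimately have "b' = b \<and> p' = p \<and> q' = q" by (rule uni)
      then show "e = (g, \<tau> g ` set b)" using e' unshift[OF x'(1) e'(2)] by (simp add: g_def)
    qed
  next
    case (7 c x s)
    then have cx: "c \<in> {0..<n}" "x \<in> {0..<n}" "\<not> h dvd c - x" by (simp_all add: D)
    then have "\<not> h dvd x - c" by (simp add: dvd_diff_commute)
    then have "(x - c) mod n \<in> ?R" using n hn by (simp add: R dvd_mod_iff)
    then obtain b p where
      b: "(b, p) \<in> set (class_entries bs s)" "fst p = (x - c) mod n"
      and uni: "\<And>b' p'. \<lbrakk>(b', p') \<in> set (class_entries bs s); fst p' = (x - c) mod n\<rbrakk>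
        \<Longrightarrow> b' = b \<and> p' = p"
      by (rule ex1_keyE[OF cls]) (rule that)
    have x: "(fst p + c) mod n = x" using cx(2) by (simp add: b(2) mod_add_left_eq)
    show ?case
    proof (rule ex1I[of _ "\<tau> c ` set b"])
      have "(x, s) = \<tau> c p" using b(1) x by (auto simp: \<tau>_def set_class_entries prod_eq_iff)
      then show "(c, \<tau> c ` set b) \<in> ?F \<and> (x, s) \<in> \<tau> c ` set b"
        using b(1) cx(1) by (auto simp: set_class_entries)
      fix B assume B: "(c, B) \<in> ?F \<and> (x, s) \<in> B"
      then obtain b' p' where e': "B = \<tau> c ` set b'" "b' \<in> set bs" "p' \<in> set b'" "(x, s) = \<tau> c p'"
        by auto
      then have x': "x = (fst p' + c) mod n" "snd p' = s" by (auto simp: \<tau>_def prod_eq_iff)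
      have "fst p' = (x - c) mod n"
        using unshift[of x c "fst p'"] x'(1) in_range[OF e'(2,3)] by (simp add: add.commute)
      then have "b' = b \<and> p' = p" using uni[of b' p'] e' x' by (simp add: set_class_entries)
      then show "B = \<tau> c ` set b" using e' by simp
    qed
  qed
  then show ?thesis unfolding framed_def by blast
qed

section \<open>Frames given by explicit lists of blocks\<close>

text \<open>In a \<open>starter n n\<close>, the pairs \<open>{x, y}\<close> taken from
  \<open>Ps\<close> form a starter of Z_n in the classical sense: they partition the nonzero
  residues, and their differences cover these once. The entry \<open>c\<close> is the point of the
  subdesign attached to the pair.\<close>

definition blocks_of :: "(int \<times> int \<times> int) list \<Rightarrow> (int \<times> int \<times> int) list \<Rightarrow> (int \<times> bool) list list" where
  "blocks_of Ts Ps = map (\<lambda>(a, b, c). [(a, True), (b, True), (c, True)]) Ts @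
     map (\<lambda>(x, y, c). [(c, True), (x, False), (y, False)]) Ps"

definition entries :: "(int \<times> (int \<times> bool) list) list \<Rightarrow> bool \<Rightarrow> ((int \<times> (int \<times> bool) list) \<times> int \<times> bool) list" where
  "entries F s = [((c, b), p). (c, b) \<leftarrow> F, p \<leftarrow> b, snd p = s]"

definition pair_entries ::
  "(int \<times> (int \<times> bool) list) list \<Rightarrow> bool \<Rightarrow> bool \<Rightarrow> ((int \<times> (int \<times> bool) list) \<times> (int \<times> bool) \<times> (int \<times> bool)) list" where
  "pair_entries F s t = [((c, b), p, q). (c, b) \<leftarrow> F, p \<leftarrow> b, q \<leftarrow> b, p \<noteq> q, snd p = s, snd q = t]"

text \<open>A pair of labels is coded as the two-digit number \<open>n * x + y\<close> in base
  \<open>n\<close>, so that sorting compares integers. \<open>List.product\<close> enumerates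
  lexicographically, so \<open>R\<close> is increasing as it stands.\<close>

definition frame_list :: "int \<Rightarrow> int \<Rightarrow> (int \<times> (int \<times> bool) list) list \<Rightarrow> bool" where
  "frame_list n w F \<longleftrightarrow>
     list_all (\<lambda>(c, b). 0 \<le> c \<and> c < n \<and> block_shape b \<and> list_all (\<lambda>p. 0 \<le> fst p \<and> fst p < n) b) F \<and>
     (let R = map (\<lambda>(x, y). n * x + y) (filter (\<lambda>(x, y). x div w \<noteq> y div w) (List.product [0..n - 1] [0..n - 1])) in
       list_all (\<lambda>s. sort (map (\<lambda>(e, p). n * fst e + fst p) (entries F s)) = R) [True, False] \<and>
       list_all (\<lambda>(s, t). sort (map (\<lambda>(e, p, q). n * fst p + fst q) (pair_entries F s t)) = R)
         [(True, True), (False, False), (True, False), (False, True)])"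

lemma set_entries:
  "((c, b), p) \<in> set (entries F s) \<longleftrightarrow> (c, b) \<in> set F \<and> p \<in> set b \<and> snd p = s"
  by (auto simp: entries_def)

lemma set_pair_entries:
  "((c, b), p, q) \<in> set (pair_entries F s t) \<longleftrightarrow>
     (c, b) \<in> set F \<and> p \<in> set b \<and> q \<in> set b \<and> p \<noteq> q \<and> snd p = s \<and> snd q = t"
  by (auto simp: pair_entries_def)

lemma framed_if_frame_list:
  assumes "frame_list n w F"
  shows "framed (multipartite {0..<n} (\<lambda>x. x div w))"
proof -
  define R where "R = map (\<lambda>(x, y). n * x + y) (filter (\<lambda>(x, y). x div w \<noteq> y div w) (List.product [0..n - 1] [0..n - 1]))"
  have shape: "block_shape b" and rng: "0 \<le> c" "c < n" "\<And>p. p \<in> set b \<Longrightarrow> 0 \<le> fst p \<and> fst p < n"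
    if "(c, b) \<in> set F" for c b
    using assms that by (auto simp: frame_list_def list_all_iff Let_def)
  have csort: "sort (map (\<lambda>(e, p). n * fst e + fst p) (entries F s)) = R" for s
    using assms by (cases s) (auto simp: frame_list_def Let_def R_def)
  have psort: "sort (map (\<lambda>(e, p, q). n * fst p + fst q) (pair_entries F s t)) = R" for s t
    using assms by (cases s; cases t) (auto simp: frame_list_def Let_def R_def)
  have code_inj: "x = x' \<and> y = y'" if "n * x + y = n * x' + y'" "0 \<le> y" "y < n" "0 \<le> y'" "y' < n" for x y x' y'
  proof -
    have *: "(n * u + v) div n = u" if "0 \<le> v" "v < n" for u v using that by simp
    have "x = x'" using *[OF that(2,3), of x] *[OF that(4,5), of x'] that(1) by simp
    then show ?thesis using that(1) by simp
  qed
  let ?D = "multipartite {0..<n} (\<lambda>x. x div w)"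
  define xs where "xs = filter (\<lambda>(x, y). x div w \<noteq> y div w) (List.product [0..n - 1] [0..n - 1])"
  have R_map: "R = map (\<lambda>(x, y). n * x + y) xs"
    by (simp add: R_def xs_def)
  have set_xs: "set xs = ?D" by (auto simp: xs_def multipartite_def)
  have inj: "inj_on (\<lambda>(x, y). n * x + y) ?D"
    by (rule inj_onI) (auto simp: multipartite_def dest: code_inj)
  have memR: "n * x + y \<in> set R \<longleftrightarrow> (x, y) \<in> ?D" if y: "0 \<le> y" "y < n" for x y
  proof
    assume "n * x + y \<in> set R"
    then obtain x' y' where eq: "n * x + y = n * x' + y'" and D: "(x', y') \<in> ?D"
      unfolding R_map set_map set_xs by auto
    then have "0 \<le> y'" "y' < n" by (auto simp: multipartite_def)
    then show "(x, y) \<in> ?D" using code_inj[OF eq y] D by simp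
  next
    assume "(x, y) \<in> ?D"
    then show "n * x + y \<in> set R" unfolding R_map set_map set_xs by force
  qed
  have distR: "distinct R"
  proof -
    have "distinct xs"
      by (simp add: xs_def distinct_product)
    then show ?thesis using inj by (simp add: R_map distinct_map set_xs)
  qed
  have in_cls: "(c, fst p) \<in> ?D" if "(c, b) \<in> set F" "p \<in> set b" for c b p
  proof -
    have "((c, b), p) \<in> set (entries F (snd p))" using that by (simp add: set_entries)
    then have "n * c + fst p \<in> (\<lambda>(e, p). n * fst e + fst p) ` set (entries F (snd p))" by force
    also have "\<dots> = set R" using arg_cong[OF csort, of set] by simp
    finally show ?thesis using memR rng(3)[OF that] by simp
  qed
  have in_pair: "(fst p, fst q) \<in> ?D" if "(c, b) \<in> set F" "p \<in> set b" "q \<in> set b" "p \<noteq> q" for c b p q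
  proof -
    have "((c, b), p, q) \<in> set (pair_entries F (snd p) (snd q))" using that by (simp add: set_pair_entries)
    then have "n * fst p + fst q \<in> (\<lambda>(e, p, q). n * fst p + fst q) ` set (pair_entries F (snd p) (snd q))" by force
    also have "\<dots> = set R" using arg_cong[OF psort, of set] by simp
    finally show ?thesis using memR rng(3)[OF that(1,3)] by simp
  qed
  let ?F = "(\<lambda>(c, b). (c, set b)) ` set F"
  have "frame ?D ?F"
    unfolding frame_def
  proof (intro conjI allI impI, goal_cases)
    case 1
    then show ?case by (auto simp: irrefl_def multipartite_def)
  next
    case (2 c B)
    then show ?case using block_shapeD(1)[OF shape] by auto
  next
    case (3 c B)
    then show ?case using in_cls by auto
  next
    case (4 c B)
    then obtain b where b: "(c, b) \<in> set F" "B = set b" by auto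
    show ?case using in_pair[OF b(1)] unfolding b(2) by blast
  next
    case (5 c B)
    then obtain b where b: "(c, b) \<in> set F" "B = set b" by auto
    show ?case using block_shapeD(2)[OF shape[OF b(1)]] b(2) by blast
  next
    case (6 x y s t)
    then have y: "0 \<le> y" "y < n" by (auto simp: multipartite_def)
    have "n * x + y \<in> set R" using 6 memR[OF y] by simp
    then obtain e p q where
      e: "(e, p, q) \<in> set (pair_entries F s t)" "n * fst p + fst q = n * x + y"
      and uni: "\<And>e' p' q'. \<lbrakk>(e', p', q') \<in> set (pair_entries F s t); n * fst p' + fst q' = n * x + y\<rbrakk>
        \<Longrightarrow> e' = e \<and> p' = p \<and> q' = q"
      by (rule ex1_tripleE[OF ex1_if_sort_map_eq[OF psort distR]]) (rule that)
    obtain c b where cb: "e = (c, b)" by (cases e)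
    then have b: "(c, b) \<in> set F" "p \<in> set b" "q \<in> set b" "snd p = s" "snd q = t"
      using e(1) by (simp_all add: set_pair_entries)
    have "fst p = x" "fst q = y" using code_inj[OF e(2)] rng(3)[OF b(1,3)] y by simp_all
    then have pq: "p = (x, s)" "q = (y, t)" using b by (simp_all add: prod_eq_iff)
    show ?case
    proof (rule ex1I[of _ "(c, set b)"])
      show "(c, set b) \<in> ?F \<and> (x, s) \<in> snd (c, set b) \<and> (y, t) \<in> snd (c, set b)"
        using b pq by auto
      fix e' assume e': "e' \<in> ?F \<and> (x, s) \<in> snd e' \<and> (y, t) \<in> snd e'"
      then obtain c' b' where b': "(c', b') \<in> set F" "e' = (c', set b')" by auto
      have "x \<noteq> y" using 6 by (auto simp: multipartite_def)
      then have "((c', b'), (x, s), (y, t)) \<in> set (pair_entries F s t)"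
        using b' e' by (simp add: set_pair_entries)
      then have "(c', b') = e" using uni by simp
      then show "e' = (c, set b)" using b' cb by simp
    qed
  next
    case (7 c x s)
    then have x: "0 \<le> x" "x < n" by (auto simp: multipartite_def)
    have "n * c + x \<in> set R" using 7 memR[OF x] by simp
    then obtain e p where
      e: "(e, p) \<in> set (entries F s)" "n * fst e + fst p = n * c + x"
      and uni: "\<And>e' p'. \<lbrakk>(e', p') \<in> set (entries F s); n * fst e' + fst p' = n * c + x\<rbrakk>
        \<Longrightarrow> e' = e \<and> p' = p"
      by (rule ex1_keyE[OF ex1_if_sort_map_eq[OF csort distR]]) (rule that)
    obtain c' b where cb: "e = (c', b)" by (cases e)
    then have b: "(c', b) \<in> set F" "p \<in> set b" "snd p = s"
      using e(1) by (simp_all add: set_entries)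
    have "c' = c" "fst p = x" using code_inj[OF e(2)] rng(3)[OF b(1,2)] x cb by simp_all
    then have p: "(c, b) \<in> set F" "p = (x, s)" using b by (simp_all add: prod_eq_iff)
    show ?case
    proof (rule ex1I[of _ "set b"])
      show "(c, set b) \<in> ?F \<and> (x, s) \<in> set b" using b p by auto
      fix B assume B: "(c, B) \<in> ?F \<and> (x, s) \<in> B"
      then obtain b' where b': "(c, b') \<in> set F" "B = set b'" by auto
      then have "((c, b'), (x, s)) \<in> set (entries F s)"
        using B by (simp add: set_entries)
      then have "(c, b') = e" using uni by simp
      then show "B = set b" using b' cb by simp
    qed
  qed
  then show ?thesis unfolding framed_def by blast
qed

section \<open>Transversal designs\<close>

text \<open>The form of an orthogonal array: every group is a copy of \<open>L\<close>, and
  \<open>v t i\<close> is the point where block \<open>t\<close> meets group \<open>i\<close>.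
  Blocks are abstract indices, so lines given by parameters and rows of a table fit the same
  notion.\<close>

definition transversal_design :: "nat \<Rightarrow> 'l set \<Rightarrow> 't set \<Rightarrow> ('t \<Rightarrow> nat \<Rightarrow> 'l) \<Rightarrow> bool" where
  "transversal_design k L T v \<longleftrightarrow>
     (\<forall>t\<in>T. \<forall>i<k. v t i \<in> L) \<and>
     (\<forall>i<k. \<forall>j<k. i \<noteq> j \<longrightarrow> (\<forall>a\<in>L. \<forall>b\<in>L. \<exists>!t. t \<in> T \<and> v t i = a \<and> v t j = b))"

lemma transversal_design_ex1:
  "\<lbrakk>transversal_design k L T v; i < k; j < k; i \<noteq> j; a \<in> L; b \<in> L\<rbrakk>
    \<Longrightarrow> \<exists>!t. t \<in> T \<and> v t i = a \<and> v t j = b"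
  by (simp add: transversal_design_def)

text \<open>MacNeish's product: two entries of a pair of blocks determine each factor separately. It
  supplies order 16 as 4 times 4.\<close>

lemma transversal_design_prod:
  assumes "transversal_design k L T v" "transversal_design k L' T' v'"
  shows "transversal_design k (L \<times> L') (T \<times> T') (\<lambda>(t, t') i. (v t i, v' t' i))"
  unfolding transversal_design_def
proof (intro conjI ballI allI impI, goal_cases)
  case (1 t i)
  then show ?case using assms unfolding transversal_design_def by auto
next
  case (2 i j a b)
  then have "fst a \<in> L" "fst b \<in> L" "snd a \<in> L'" "snd b \<in> L'" by auto
  note ab = this
  obtain t where t: "t \<in> T \<and> v t i = fst a \<and> v t j = fst b"
    and t_uni: "\<forall>u. u \<in> T \<and> v u i = fst a \<and> v u j = fst b \<longrightarrow> u = t"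
    using transversal_design_ex1[OF assms(1) 2(1-3) ab(1,2)] by (rule ex1E)
  obtain t' where t': "t' \<in> T' \<and> v' t' i = snd a \<and> v' t' j = snd b"
    and t'_uni: "\<forall>u. u \<in> T' \<and> v' u i = snd a \<and> v' u j = snd b \<longrightarrow> u = t'"
    using transversal_design_ex1[OF assms(2) 2(1-3) ab(3,4)] by (rule ex1E)
  show ?case
  proof (rule ex1I[of _ "(t, t')"])
    show "(t, t') \<in> T \<times> T' \<and> (case (t, t') of (t, t') \<Rightarrow> \<lambda>i. (v t i, v' t' i)) i = a \<and>
        (case (t, t') of (t, t') \<Rightarrow> \<lambda>i. (v t i, v' t' i)) j = b"
      using t t' by (simp add: prod_eq_iff)
    fix w assume w: "w \<in> T \<times> T' \<and> (case w of (t, t') \<Rightarrow> \<lambda>i. (v t i, v' t' i)) i = a \<and>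
        (case w of (t, t') \<Rightarrow> \<lambda>i. (v t i, v' t' i)) j = b"
    obtain p q where pq: "w = (p, q)" by (cases w)
    have "p = t" using w pq by (intro t_uni[rule_format]) auto
    moreover have "q = t'" using w pq by (intro t'_uni[rule_format]) auto
    ultimately show "w = (t, t')" using pq by simp
  qed
qed

text \<open>Subtracting the equations of the two lines leaves \<open>(i - j) * b = x - y\<close>,
  which has one solution since \<open>i - j\<close> is a unit modulo \<open>m\<close>; then
  \<open>a\<close> is forced.\<close>

lemma ex1_two_slopes:
  fixes m :: int
  assumes "0 < m" "coprime (i - j) m" "x \<in> {0..<m}" "y \<in> {0..<m}"
  shows "\<exists>!t. t \<in> {0..<m} \<times> {0..<m} \<and>
    (fst t + i * snd t) mod m = x \<and> (fst t + j * snd t) mod m = y"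
proof -
  obtain r where r: "[(i - j) * r = 1] (mod m)" using cong_solve_coprime_int[OF assms(2)] by blast
  define b where "b = ((x - y) * r) mod m"
  define a where "a = (x - i * b) mod m"
  have rng: "a \<in> {0..<m}" "b \<in> {0..<m}" using assms(1) by (auto simp: a_def b_def)
  have a: "[a = x - i * b] (mod m)" and b0: "[b = (x - y) * r] (mod m)" by (simp_all add: a_def b_def cong_def)
  have b: "[(i - j) * b = x - y] (mod m)"
  proof -
    have "[(i - j) * b = (i - j) * ((x - y) * r)] (mod m)" by (rule cong_scalar_left[OF b0])
    also have "(i - j) * ((x - y) * r) = (x - y) * ((i - j) * r)" by simp
    also have "[\<dots> = (x - y) * 1] (mod m)" by (rule cong_scalar_left[OF r])
    finally show ?thesis by simp
  qed
  show ?thesis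
  proof (rule ex1I[of _ "(a, b)"])
    have "[a + i * b = x] (mod m)" using cong_add[OF a cong_refl[of "i * b"]] by simp
    moreover have "[a + i * b - (i - j) * b = x - (x - y)] (mod m)" by (rule cong_diff[OF calculation b])
    then have "[a + j * b = y] (mod m)" by (simp add: algebra_simps)
    ultimately show "(a, b) \<in> {0..<m} \<times> {0..<m} \<and>
        (fst (a, b) + i * snd (a, b)) mod m = x \<and> (fst (a, b) + j * snd (a, b)) mod m = y"
      using rng assms(3,4) by (simp add: cong_def)
    fix t assume t: "t \<in> {0..<m} \<times> {0..<m} \<and> (fst t + i * snd t) mod m = x \<and> (fst t + j * snd t) mod m = y"
    obtain a' b' where ab: "t = (a', b')" by (cases t)
    have 1: "[a' + i * b' = x] (mod m)" "[a' + j * b' = y] (mod m)"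
      using t ab assms(3,4) by (auto simp: cong_def)
    have 2: "[(i - j) * b' = x - y] (mod m)" using cong_diff[OF 1] by (simp add: algebra_simps)
    have "[r * ((i - j) * b') = r * ((i - j) * b)] (mod m)"
      by (rule cong_scalar_left[OF cong_trans[OF 2 cong_sym[OF b]]])
    moreover have "[r * ((i - j) * u) = u] (mod m)" for u
    proof -
      have "[u * ((i - j) * r) = u * 1] (mod m)" by (rule cong_scalar_left[OF r])
      then show ?thesis by (simp add: mult_ac)
    qed
    ultimately have "[b' = b] (mod m)" by (meson cong_sym cong_trans)
    then have bb: "b' = b" using t ab rng by (simp add: cong_def)
    have "[a' = x - i * b'] (mod m)" using cong_diff[OF 1(1) cong_refl[of "i * b'"]] by simp
    then have "[a' = a] (mod m)" using a bb by (meson cong_sym cong_trans)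
    then show "t = (a, b)" using t ab bb rng by (simp add: cong_def)
  qed
qed

text \<open>The blocks are the lines of slope 0, 1, 2, 3 read as functions, with the slope parameter
  itself as fifth coordinate. Differences of the four slopes have absolute value at most 3, hence
  divide 6 and are units modulo \<open>m\<close>.\<close>

lemma transversal_design_coprime_6:
  assumes m: "0 < m" and cop6: "coprime m (6 :: int)"
  shows "transversal_design 5 {0..<m} ({0..<m} \<times> {0..<m})
    (\<lambda>t i. if i = 4 then snd t else (fst t + int i * snd t) mod m)"
proof -
  let ?v = "\<lambda>(t :: int \<times> int) (i :: nat). if i = 4 then snd t else (fst t + int i * snd t) mod m"
  have cop: "coprime d m" if "d \<in> {-3, -2, -1, 1, 2, 3}" for d
  proof -
    have "d dvd 6" using that by auto
    then show ?thesis using cop6 coprime_divisors[of d 6 m m] by (simp add: coprime_commute)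
  qed
  have *: "\<exists>!t. t \<in> {0..<m} \<times> {0..<m} \<and> ?v t i = x \<and> ?v t j = y"
    if ij: "i < 5" "j < 5" "i \<noteq> j" "i \<noteq> 4" and xy: "x \<in> {0..<m}" "y \<in> {0..<m}" for i j x y
  proof (cases "j = 4")
    case True
    show ?thesis
    proof (rule ex1I[of _ "((x - int i * y) mod m, y)"])
      fix t assume t: "t \<in> {0..<m} \<times> {0..<m} \<and> ?v t i = x \<and> ?v t j = y"
      then have "x = (fst t + int i * y) mod m" "snd t = y" using True ij by auto
      then have "(x - int i * y) mod m = fst t" using t by (auto simp: mod_diff_left_eq)
      then show "t = ((x - int i * y) mod m, y)" using \<open>snd t = y\<close> by (simp add: prod_eq_iff)
    qed (use True ij xy m in \<open>auto simp: mod_add_left_eq\<close>)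
  next
    case False
    have "int i - int j \<in> {-3, -2, -1, 1, 2, 3}" using ij False by auto
    from ex1_two_slopes[OF m cop[OF this] xy] show ?thesis using ij(4) False by simp
  qed
  show ?thesis
    unfolding transversal_design_def
  proof (intro conjI ballI allI impI, goal_cases)
    case (1 t i)
    then show ?case using m by auto
  next
    case (2 i j a b)
    show ?case
    proof (cases "i = 4")
      case True
      then show ?thesis using *[of j i b a] 2 by (simp add: conj_commute)
    next
      case False
      then show ?thesis using *[of i j a b] 2 by simp
    qed
  qed
qed

section \<open>Complete graphs from truncated transversal designs\<close>

definition complete_framed :: "nat \<Rightarrow> bool" where
  "complete_framed u \<longleftrightarrow> framed (multipartite {0..<int u} id)"

lemma framed_complete:
  assumes "complete_framed u" "finite A" "card A = u"
  shows "framed (multipartite A id)"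
proof -
  have "\<exists>f. bij_betw f {0..<int u} A" using assms by (intro finite_same_card_bij) auto
  then obtain f where f: "bij_betw f {0..<int u} A" by blast
  show ?thesis
    by (rule framed_image[OF assms(1)[unfolded complete_framed_def] f])
      (use f in \<open>auto simp: bij_betw_def inj_on_def\<close>)
qed

lemma framed_groups:
  assumes fr: "framed (multipartite {0..<int (6 * k)} (\<lambda>x. x div 6))" and J: "finite J" "card J = k"
  shows "framed (multipartite (J \<times> {..<6::nat}) fst)"
proof -
  obtain f where f: "bij_betw f {0..<k} J" using ex_bij_betw_nat_finite[OF J(1)] J(2) by blast
  let ?g = "\<lambda>x::int. (f (nat (x div 6)), nat (x mod 6))"
  have rng: "nat (x div 6) \<in> {0..<k}" "nat (x mod 6) < 6" if "x \<in> {0..<int (6 * k)}" for x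
    using that by auto
  have feq: "f (nat (x div 6)) = f (nat (y div 6)) \<longleftrightarrow> x div 6 = y div 6"
    if "x \<in> {0..<int (6 * k)}" "y \<in> {0..<int (6 * k)}" for x y
  proof -
    have "f (nat (x div 6)) = f (nat (y div 6)) \<longleftrightarrow> nat (x div 6) = nat (y div 6)"
      using inj_on_eq_iff[OF bij_betw_imp_inj_on[OF f] rng(1)[OF that(1)] rng(1)[OF that(2)]] .
    also have "\<dots> \<longleftrightarrow> x div 6 = y div 6"
      using that by (simp add: eq_nat_nat_iff pos_imp_zdiv_nonneg_iff)
    finally show ?thesis .
  qed
  have inj: "inj_on ?g {0..<int (6 * k)}"
  proof (rule inj_onI)
    fix x y assume x: "x \<in> {0..<int (6 * k)}" "y \<in> {0..<int (6 * k)}" "?g x = ?g y"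
    then have "x div 6 = y div 6" "x mod 6 = y mod 6" using feq by (simp_all add: eq_nat_nat_iff)
    then show "x = y" by (metis div_mult_mod_eq)
  qed
  have "?g ` {0..<int (6 * k)} = J \<times> {..<6}"
  proof (rule card_subset_eq)
    show "?g ` {0..<int (6 * k)} \<subseteq> J \<times> {..<6}"
      using bij_betwE[OF f] rng by blast
    show "card (?g ` {0..<int (6 * k)}) = card (J \<times> {..<6::nat})"
      unfolding card_image[OF inj] using J(2) by (simp add: card_cartesian_product)
  qed (use J in simp)
  with inj have "bij_betw ?g {0..<int (6 * k)} (J \<times> {..<6})" by (simp add: bij_betw_def)
  then show ?thesis
  proof (rule framed_image[OF fr])
    fix x y :: int assume x: "x \<in> {0..<int (6 * k)}" "y \<in> {0..<int (6 * k)}"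
    then show "x div 6 = y div 6 \<longleftrightarrow> fst (?g x) = fst (?g y)" using feq by simp
  qed
qed

lemma complete_framedI:
  assumes "framed (multipartite A id)" "finite A" "card A = u"
  shows "complete_framed u"
proof -
  have "\<exists>f. bij_betw f A {0..<int u}" using assms by (intro finite_same_card_bij) auto
  then obtain f where f: "bij_betw f A {0..<int u}" by blast
  show ?thesis
    unfolding complete_framed_def
    by (rule framed_image[OF assms(1) f]) (use f in \<open>auto simp: bij_betw_def inj_on_def\<close>)
qed

text \<open>Wilson's construction. \<open>None\<close> is the added point and
  \<open>Some (j, a, e)\<close> is copy \<open>e\<close> of point \<open>a\<close> in group
  \<open>j\<close>. Points of different groups are joined by the unique block through the two points
  that they copy. Copies of one point form a group of size 6 in every \<open>B u\<close>, so they
  are not joined there; they are joined within \<open>G j\<close>, as are all points of one group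
  and \<open>None\<close>.\<close>

lemma complete_framed_transversal:
  assumes td: "transversal_design 5 L T v" and L: "finite L" "card L = m" and t: "t \<le> m"
    and cm: "complete_framed (6 * m + 1)" and ct: "complete_framed (6 * t + 1)"
    and f4: "framed (multipartite {0..<24 :: int} (\<lambda>x. x div 6))"
    and f5: "framed (multipartite {0..<30 :: int} (\<lambda>x. x div 6))"
  shows "complete_framed (6 * (4 * m + t) + 1)"
proof -
  obtain L' where L': "L' \<subseteq> L" "card L' = t" using t L(2) by (metis obtain_subset_with_card_n)
  define S where "S j = (if j < (4::nat) then L else L')" for j
  have S: "S j \<subseteq> L" "finite (S j)" for j using L(1) L'(1) by (auto simp: S_def finite_subset)
  define G where "G j = insert None (Some ` ({j} \<times> S j \<times> {..<6::nat}))" for j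
  define X where "X = insert None (Some ` (SIGMA j:{..<5::nat}. S j \<times> {..<6::nat}))"
  \<comment> \<open>The groups in which block \<open>u\<close> keeps its point: always the four full
    ones, and the truncated group if its point survives. This gives the types 6^4 and 6^5.\<close>
  define J where "J u = {j. j < 5 \<and> v u j \<in> S j}" for u
  define B where "B u = (\<lambda>(j, e). Some (j, v u j, e)) ` (J u \<times> {..<6::nat})" for u
  define D where "D = case_sum (\<lambda>u. multipartite (B u) (\<lambda>p. fst (the p))) (\<lambda>j. Restr (- Id) (G j))"
  let ?I = "T <+> {..<5::nat}"
  have DB: "(p, q) \<in> D (Inl u) \<longleftrightarrow> (\<exists>j e j' e'. p = Some (j, v u j, e) \<and> q = Some (j', v u j', e') \<and>
      j \<in> J u \<and> j' \<in> J u \<and> e < 6 \<and> e' < 6 \<and> j \<noteq> j')" for p q u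
    by (auto simp: D_def B_def multipartite_def)
  have DG: "(p, q) \<in> D (Inr j) \<longleftrightarrow> p \<in> G j \<and> q \<in> G j \<and> p \<noteq> q" for p q j
    by (auto simp: D_def)
  have JJ: "{0..<4} \<subseteq> J u" "J u \<subseteq> {0..<5}" if "u \<in> T" for u
    using td that by (auto simp: J_def S_def transversal_design_def)
  have uni: "u = u'" if "u \<in> T" "u' \<in> T" "j \<in> J u" "j' \<in> J u" "j \<noteq> j'" "v u j = v u' j" "v u j' = v u' j'" for u u' j j'
    using transversal_design_ex1[OF td, of j j' "v u j" "v u j'"] that S by (auto simp: J_def)
  have "framed (D i)" if "i \<in> ?I" for i
  proof (cases i)
    case (Inl u)
    then have u: "u \<in> T" using that by auto
    have fin: "finite (J u)" using JJ(2)[OF u] finite_subset by blast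
    have "J u = {0..<4} \<or> J u = {0..<5}"
    proof -
      have five: "{0..<5} = insert 4 {0..<4::nat}" by auto
      show ?thesis
      proof (cases "4 \<in> J u")
        case True
        then show ?thesis using JJ[OF u] unfolding five by auto
      next
        case False
        then show ?thesis using JJ[OF u] unfolding five by auto
      qed
    qed
    then have "card (J u) = 4 \<or> card (J u) = 5" by auto
    then have "framed (multipartite (J u \<times> {..<6::nat}) fst)"
      using framed_groups[of 4 "J u"] framed_groups[of 5 "J u"] fin f4 f5 by auto
    moreover have "bij_betw (\<lambda>(j, e). Some (j, v u j, e)) (J u \<times> {..<6::nat}) (B u)"
      by (auto simp: bij_betw_def B_def inj_on_def)
    ultimately have "framed (multipartite (B u) (\<lambda>p. fst (the p)))"
      by (rule framed_image) auto
    then show ?thesis by (simp add: Inl D_def)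
  next
    case (Inr j)
    have "card (G j) = 6 * card (S j) + 1" "finite (G j)"
      using S by (auto simp: G_def card_image card_insert_if image_iff)
    moreover have "card (S j) = m \<or> card (S j) = t" using L L' by (auto simp: S_def)
    ultimately have "framed (multipartite (G j) id)"
      using framed_complete[OF cm] framed_complete[OF ct] by auto
    moreover have "multipartite (G j) id = D (Inr j)" by (auto simp: multipartite_def D_def)
    ultimately show ?thesis using Inr by simp
  qed
  moreover have "disjoint_family_on D ?I"
    unfolding disjoint_family_on_def
  proof (intro ballI impI, rule ccontr)
    fix i i' assume i: "i \<in> ?I" "i' \<in> ?I" "i \<noteq> i'" "D i \<inter> D i' \<noteq> {}"
    then obtain p q where pq: "(p, q) \<in> D i" "(p, q) \<in> D i'" by auto
    show False
    proof (cases i; cases i')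
      fix u u' assume *: "i = Inl u" "i' = Inl u'"
      with pq obtain j e j' e' where "p = Some (j, v u j, e)" "q = Some (j', v u j', e')"
        "j \<in> J u" "j' \<in> J u" "j \<noteq> j'" "v u j = v u' j" "v u j' = v u' j'"
        by (auto simp: DB)
      then have "u = u'" using uni[of u u' j j'] * i(1,2) by auto
      then show False using * i(3) by simp
    next
      fix u j assume "i = Inl u" "i' = Inr j"
      then show False using pq by (auto simp: DB DG G_def)
    next
      fix u j assume "i = Inr j" "i' = Inl u"
      then show False using pq by (auto simp: DB DG G_def)
    next
      fix j j' assume "i = Inr j" "i' = Inr j'"
      then show False using pq i(3) by (auto simp: DG G_def)
    qed
  qed
  ultimately have "framed (\<Union>i\<in>?I. D i)" by (rule framed_UN)
  moreover have "(\<Union>i\<in>?I. D i) = multipartite X id"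
  proof (intro equalityI subrelI)
    fix p q assume "(p, q) \<in> (\<Union>i\<in>?I. D i)"
    then consider u where "u \<in> T" "(p, q) \<in> D (Inl u)" | j where "j < 5" "(p, q) \<in> D (Inr j)" by auto
    then show "(p, q) \<in> multipartite X id"
      by cases (auto simp: DB DG G_def X_def J_def multipartite_def)
  next
    fix p q assume pq: "(p, q) \<in> multipartite X id"
    then have ne: "p \<noteq> q" "p \<in> X" "q \<in> X" by (auto simp: multipartite_def)
    show "(p, q) \<in> (\<Union>i\<in>?I. D i)"
    proof (cases "\<exists>j<5. p \<in> G j \<and> q \<in> G j")
      case True
      then obtain j where "j < 5" "(p, q) \<in> D (Inr j)" using ne by (auto simp: DG)
      then show ?thesis by blast
    next
      case False
      then have "p \<noteq> None" "q \<noteq> None" using ne by (auto simp: X_def G_def)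
      then obtain j a e where p: "p = Some (j, a, e)" "j < 5" "a \<in> S j" "e < 6"
        using ne(2) by (auto simp: X_def)
      from \<open>q \<noteq> None\<close> obtain j' a' e' where q: "q = Some (j', a', e')" "j' < 5" "a' \<in> S j'" "e' < 6"
        using ne(3) by (auto simp: X_def)
      have "j \<noteq> j'" using False p q by (auto simp: G_def)
      moreover obtain u where u: "u \<in> T" "v u j = a" "v u j' = a'"
        using transversal_design_ex1[OF td p(2) q(2) \<open>j \<noteq> j'\<close>, of a a'] p(3) q(3) S(1) by blast
      ultimately have "(p, q) \<in> D (Inl u)" using p q by (auto simp: DB J_def)
      then show ?thesis using u(1) by blast
    qed
  qed
  moreover have "finite X" using S by (auto simp: X_def)
  moreover have "card X = 6 * (4 * m + t) + 1"
  proof -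
    have "card (SIGMA j:{..<5::nat}. S j \<times> {..<6::nat}) = (\<Sum>j<5. card (S j \<times> {..<6::nat}))"
      using S by (intro card_SigmaI) auto
    also have "\<dots> = 6 * (\<Sum>j<5. card (S j))"
      by (simp add: card_cartesian_product sum_distrib_left mult.commute)
    also have "(\<Sum>j<5. card (S j)) = 4 * m + t"
      using L(2) L'(2) by (simp add: S_def lessThan_nat_numeral lessThan_Suc)
    finally show ?thesis using S by (simp add: X_def card_image card_insert_if image_iff)
  qed
  ultimately show ?thesis by (metis complete_framedI)
qed

section \<open>Transversal designs over GF(4) and GF(9)\<close>

definition oa_check :: "int \<Rightarrow> int list list \<Rightarrow> bool" where
  "oa_check n ts \<longleftrightarrow>
     list_all (\<lambda>t. length t = 5 \<and> list_all (\<lambda>x. 0 \<le> x \<and> x < n) t) ts \<and>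
     list_all (\<lambda>(i, j). sort (map (\<lambda>t. n * t ! i + t ! j) ts) = [0..n * n - 1])
       [(0, 1), (0, 2), (0, 3), (0, 4), (1, 2), (1, 3), (1, 4), (2, 3), (2, 4), (3, 4)]"

lemma transversal_design_if_oa_check:
  assumes "oa_check n ts"
  shows "transversal_design 5 {0..<n} (set ts) (!)"
proof -
  have rng: "t ! i \<in> {0..<n}" if "t \<in> set ts" "i < 5" for t i
    using assms that by (auto simp: oa_check_def list_all_iff)
  have sorted: "sort (map (\<lambda>t. n * t ! i + t ! j) ts) = [0..n * n - 1]" if "i < j" "j < 5" for i j
  proof -
    have "(i, j) \<in> set [(0, 1), (0, 2), (0, 3), (0, 4), (1, 2), (1, 3), (1, 4), (2, 3), (2, 4), (3, 4)]"
      using that by (auto simp: less_Suc_eq numeral_eq_Suc)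
    then show ?thesis using assms unfolding oa_check_def list_all_iff by fast
  qed
  have *: "\<exists>!t. t \<in> set ts \<and> t ! i = a \<and> t ! j = b"
    if ij: "i < j" "j < 5" and ab: "a \<in> {0..<n}" "b \<in> {0..<n}" for i j a b
  proof -
    have "n * a + b < n * n"
    proof -
      have "n * a + b < n * (a + 1)" using ab by (simp add: distrib_left)
      also have "\<dots> \<le> n * n" using ab by (intro mult_left_mono) auto
      finally show ?thesis .
    qed
    then have "n * a + b \<in> set [0..n * n - 1]" using ab by simp
    from ex1_if_sort_map_eq[OF sorted[OF ij] distinct_upto this]
    have "\<exists>!t. t \<in> set ts \<and> n * t ! i + t ! j = n * a + b" .
    moreover have "n * t ! i + t ! j = n * a + b \<longleftrightarrow> t ! i = a \<and> t ! j = b" if "t \<in> set ts" for t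
    proof
      assume eq: "n * t ! i + t ! j = n * a + b"
      have dv: "(n * x + y) div n = x" if "y \<in> {0..<n}" for x y using that by simp
      have "t ! i = a" using dv[OF rng[OF that ij(2)], of "t ! i"] dv[OF ab(2), of a] eq by simp
      then show "t ! i = a \<and> t ! j = b" using eq by simp
    qed simp
    ultimately show ?thesis by (simp cong: conj_cong)
  qed
  show ?thesis
    unfolding transversal_design_def
  proof (intro conjI ballI allI impI, goal_cases)
    case (1 t i)
    then show ?case using rng by simp
  next
    case (2 i j a b)
    show ?case
    proof (cases "i < j")
      case True
      then show ?thesis using * 2 by simp
    next
      case False
      then have "\<exists>!t. t \<in> set ts \<and> t ! j = b \<and> t ! i = a" using *[of j i b a] 2 by simp
      then show ?thesis by (simp add: conj_commute)
    qed
  qed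
qed

text \<open>Lines of slope \<open>0, 1, \<omega>, \<omega>\<^sup>2\<close> over GF(4), where \<open>(x, y)\<close> is the element
  \<open>x + y\<omega>\<close>, and of slope \<open>0, 1, i, 1 + i\<close> over GF(9).\<close>

definition oa_4 :: "int list list" where
  "oa_4 = [[2 * a + a', 2 * ((a + b) mod 2) + (a' + b') mod 2, 2 * ((a + b') mod 2) + (a' + b + b') mod 2,
      2 * ((a + b + b') mod 2) + (a' + b) mod 2, 2 * b + b'].
     a \<leftarrow> [0..1], a' \<leftarrow> [0..1], b \<leftarrow> [0..1], b' \<leftarrow> [0..1]]"

definition oa_9 :: "int list list" where
  "oa_9 = [[3 * a + a', 3 * ((a + b) mod 3) + (a' + b') mod 3, 3 * ((a - b') mod 3) + (a' + b) mod 3,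
      3 * ((a + b - b') mod 3) + (a' + b + b') mod 3, 3 * b + b'].
     a \<leftarrow> [0..2], a' \<leftarrow> [0..2], b \<leftarrow> [0..2], b' \<leftarrow> [0..2]]"

lemma transversal_design_4: "transversal_design 5 {0..<4} (set oa_4) (!)"
  by (rule transversal_design_if_oa_check) code_simp

lemma transversal_design_9: "transversal_design 5 {0..<9} (set oa_9) (!)"
  by (rule transversal_design_if_oa_check) code_simp

section \<open>Small frames\<close>

text \<open>Multiplication by 2, of order 3 modulo 7, produces all blocks from
  \<open>(1, 2, 4)\<close> and \<open>(1, 5, 6)\<close>.\<close>

lemma starter_7_7: "starter 7 7 (blocks_of
    [(1, 2, 4)]
    [(1, 5, 6), (2, 3, 5), (4, 6, 3)])"
  by code_simp

lemma starter_13_13: "starter 13 13 (blocks_of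
    [(4, 10, 12), (7, 8, 11)]
    [(1, 11, 5), (2, 10, 3), (3, 7, 2), (4, 6, 9), (5, 12, 1), (8, 9, 6)])"
  by code_simp

lemma starter_19_19: "starter 19 19 (blocks_of
    [(1, 5, 8), (7, 16, 18), (11, 12, 17)]
    [(1, 6, 13), (2, 13, 4), (3, 10, 6), (4, 7, 15), (5, 18, 3), (8, 17, 14), (9, 11, 10),
     (12, 16, 2), (14, 15, 9)])"
  by code_simp

lemma starter_25_25: "starter 25 25 (blocks_of
    [(4, 18, 23), (5, 13, 14), (10, 20, 22), (12, 15, 19)]
    [(1, 10, 17), (2, 22, 3), (3, 24, 11), (4, 12, 1), (5, 18, 8), (6, 16, 2), (7, 13, 6),
     (8, 11, 21), (9, 23, 7), (14, 21, 16), (15, 17, 9), (19, 20, 24)])"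
  by code_simp

text \<open>Type 6^5 in cyclic form: the groups are the five cosets of 5Z in Z_30.\<close>

lemma starter_30_5: "starter 30 5 (blocks_of
    [(1, 3, 4), (2, 18, 24), (7, 11, 28), (9, 16, 27)]
    [(1, 17, 13), (2, 29, 26), (3, 26, 19), (4, 28, 17), (6, 27, 14), (7, 9, 8), (8, 21, 12),
     (11, 23, 29), (12, 16, 23), (13, 24, 22), (14, 22, 6), (18, 19, 21)])"
  by code_simp

lemma starter_31_31: "starter 31 31 (blocks_of
    [(3, 20, 21), (4, 13, 29), (6, 26, 30), (7, 12, 15), (16, 18, 28)]
    [(1, 14, 9), (2, 12, 19), (3, 30, 27), (4, 18, 23), (5, 8, 14), (6, 13, 24), (7, 16, 17),
     (9, 25, 8), (10, 29, 2), (11, 17, 1), (15, 26, 11), (19, 21, 10), (20, 28, 22),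
     (22, 27, 25), (23, 24, 5)])"
  by code_simp

lemma starter_37_37: "starter 37 37 (blocks_of
    [(2, 12, 30), (3, 15, 16), (4, 9, 20), (5, 7, 11), (13, 33, 36), (19, 27, 34)]
    [(1, 8, 32), (2, 33, 23), (3, 18, 25), (4, 24, 21), (5, 21, 10), (6, 10, 24), (7, 15, 6),
     (9, 14, 17), (11, 22, 31), (12, 31, 35), (13, 25, 26), (16, 29, 22), (17, 27, 29),
     (19, 28, 1), (20, 34, 8), (23, 26, 18), (30, 32, 28), (35, 36, 14)])"
  by code_simp

lemma starter_43_43: "starter 43 43 (blocks_of
    [(1, 31, 40), (6, 14, 25), (9, 10, 27), (11, 17, 33), (16, 23, 26), (20, 32, 34), (21, 36, 41)]
    [(1, 10, 42), (2, 14, 8), (3, 11, 13), (4, 7, 15), (5, 21, 2), (6, 17, 37), (8, 25, 29),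
     (9, 22, 38), (12, 41, 5), (13, 28, 3), (15, 37, 24), (16, 36, 7), (18, 23, 35),
     (19, 38, 22), (20, 26, 39), (24, 42, 4), (27, 34, 19), (29, 31, 30), (30, 40, 12),
     (32, 33, 28), (35, 39, 18)])"
  by code_simp

lemma starter_49_49: "starter 49 49 (blocks_of
    [(3, 6, 22), (4, 5, 10), (7, 14, 28), (12, 16, 48), (13, 38, 47), (17, 19, 39), (20, 31, 43),
     (23, 33, 41)]
    [(1, 33, 9), (2, 35, 37), (3, 44, 40), (4, 32, 42), (5, 8, 34), (6, 18, 15), (7, 26, 1),
     (9, 20, 27), (10, 30, 25), (11, 21, 32), (12, 25, 26), (13, 40, 44), (14, 45, 30),
     (15, 17, 45), (16, 31, 36), (19, 43, 11), (22, 29, 35), (23, 37, 21), (24, 47, 46),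
     (27, 28, 18), (34, 38, 8), (36, 42, 29), (39, 48, 2), (41, 46, 24)])"
  by code_simp

lemma starter_55_55: "starter 55 55 (blocks_of
    [(2, 21, 31), (3, 16, 24), (4, 7, 34), (6, 13, 30), (15, 50, 52), (17, 28, 40), (23, 37, 38),
     (29, 35, 51), (32, 36, 41)]
    [(1, 46, 39), (2, 25, 11), (3, 24, 18), (4, 45, 47), (5, 18, 22), (6, 42, 20), (7, 32, 33),
     (8, 16, 14), (9, 31, 5), (10, 26, 49), (11, 35, 10), (12, 40, 48), (13, 17, 45),
     (14, 29, 9), (15, 27, 46), (19, 20, 44), (21, 30, 42), (22, 28, 19), (23, 52, 8),
     (33, 53, 25), (34, 51, 1), (36, 54, 43), (37, 48, 27), (38, 41, 54), (39, 44, 26),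
     (43, 50, 53), (47, 49, 12)])"
  by code_simp

lemma starter_61_61: "starter 61 61 (blocks_of
    [(2, 26, 33), (3, 19, 39), (4, 5, 52), (7, 24, 30), (14, 48, 60), (18, 51, 53), (23, 44, 55),
     (27, 46, 49), (32, 40, 50), (36, 41, 45)]
    [(1, 51, 21), (2, 12, 8), (3, 59, 47), (4, 38, 22), (5, 17, 58), (6, 52, 42), (7, 42, 28),
     (8, 49, 56), (9, 32, 6), (10, 46, 9), (11, 14, 16), (13, 53, 29), (15, 33, 10),
     (16, 23, 31), (18, 47, 11), (19, 28, 13), (20, 44, 54), (21, 60, 25), (22, 24, 35),
     (25, 55, 37), (26, 34, 43), (27, 43, 57), (29, 48, 20), (30, 58, 59), (31, 45, 34),
     (35, 39, 1), (36, 37, 15), (40, 57, 38), (41, 54, 12), (50, 56, 17)])"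
  by code_simp

lemma starter_67_67: "starter 67 67 (blocks_of
    [(1, 8, 11), (3, 46, 59), (5, 9, 32), (7, 25, 66), (12, 27, 62), (14, 20, 45), (15, 31, 53),
     (22, 41, 42), (24, 58, 63), (34, 43, 64), (38, 40, 52)]
    [(1, 13, 28), (2, 62, 61), (3, 16, 10), (4, 46, 33), (5, 49, 39), (6, 43, 54), (7, 21, 56),
     (8, 65, 49), (9, 50, 51), (10, 27, 23), (11, 33, 21), (12, 36, 29), (14, 48, 57),
     (15, 61, 18), (17, 66, 19), (18, 22, 13), (19, 58, 37), (20, 60, 26), (23, 42, 6),
     (24, 44, 2), (25, 57, 30), (26, 31, 47), (28, 64, 50), (29, 32, 55), (30, 59, 44),
     (34, 35, 4), (37, 53, 65), (38, 47, 36), (39, 45, 16), (40, 51, 48), (41, 56, 60),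
     (52, 54, 17), (55, 63, 35)])"
  by code_simp

lemma starter_73_73: "starter 73 73 (blocks_of
    [(3, 31, 47), (5, 28, 40), (6, 21, 62), (7, 10, 56), (11, 24, 29), (12, 42, 51),
     (13, 15, 46), (14, 20, 39), (19, 26, 30), (22, 48, 58), (23, 43, 44), (38, 52, 60)]
    [(1, 71, 61), (2, 69, 49), (3, 50, 8), (4, 65, 25), (5, 44, 41), (6, 27, 16), (7, 47, 72),
     (8, 57, 50), (9, 32, 54), (10, 15, 9), (11, 56, 65), (12, 54, 32), (13, 68, 59),
     (14, 21, 71), (16, 41, 27), (17, 58, 33), (18, 64, 35), (19, 49, 2), (20, 30, 18),
     (22, 39, 57), (23, 67, 37), (24, 35, 64), (25, 38, 4), (26, 63, 45), (28, 42, 69),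
     (29, 45, 53), (31, 33, 34), (34, 43, 66), (36, 55, 70), (37, 72, 67), (40, 60, 36),
     (46, 61, 1), (48, 70, 55), (51, 59, 63), (52, 53, 17), (62, 66, 68)])"
  by code_simp

lemma starter_79_79: "starter 79 79 (blocks_of
    [(3, 7, 69), (6, 14, 59), (12, 28, 39), (15, 29, 35), (17, 66, 75), (24, 56, 78),
     (27, 63, 68), (30, 58, 70), (33, 48, 77), (34, 53, 71), (37, 60, 61), (41, 43, 74),
     (47, 54, 57)]
    [(1, 39, 21), (2, 78, 42), (3, 73, 32), (4, 77, 5), (5, 37, 26), (6, 67, 64), (7, 65, 22),
     (8, 75, 10), (9, 35, 31), (10, 74, 52), (11, 34, 73), (12, 55, 49), (13, 33, 36),
     (14, 51, 44), (15, 49, 2), (16, 71, 20), (17, 45, 76), (18, 70, 62), (19, 30, 4),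
     (20, 69, 25), (21, 29, 46), (22, 68, 67), (23, 28, 9), (24, 31, 19), (25, 27, 51),
     (26, 66, 72), (32, 63, 40), (36, 61, 45), (38, 60, 8), (40, 59, 50), (41, 76, 16),
     (42, 58, 13), (43, 72, 11), (44, 57, 55), (46, 56, 18), (47, 64, 1), (48, 62, 38),
     (50, 54, 23), (52, 53, 65)])"
  by code_simp

lemma starter_85_85: "starter 85 85 (blocks_of
    [(1, 25, 36), (3, 8, 28), (5, 19, 62), (7, 9, 61), (14, 78, 81), (16, 39, 75), (17, 64, 72),
     (20, 27, 73), (26, 32, 77), (31, 50, 60), (33, 42, 55), (34, 38, 82), (35, 51, 52),
     (41, 53, 68)]
    [(1, 28, 12), (2, 59, 57), (3, 76, 84), (4, 40, 69), (5, 69, 76), (6, 56, 49), (7, 61, 70),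
     (8, 45, 22), (9, 23, 15), (10, 11, 59), (12, 77, 66), (13, 21, 46), (14, 74, 48),
     (15, 84, 2), (16, 57, 74), (17, 51, 11), (18, 27, 71), (19, 72, 18), (20, 33, 43),
     (22, 60, 79), (24, 67, 29), (25, 29, 10), (26, 41, 54), (30, 32, 56), (31, 36, 58),
     (34, 53, 24), (35, 81, 47), (37, 66, 13), (38, 49, 40), (39, 65, 21), (42, 64, 80),
     (43, 83, 44), (44, 50, 65), (46, 79, 83), (47, 70, 67), (48, 78, 23), (52, 55, 6),
     (54, 71, 4), (58, 82, 37), (62, 80, 45), (63, 73, 30), (68, 75, 63)])"
  by code_simp

text \<open>Here \<open>c = x + y\<close> modulo 91 for every pair, so the mixed differences
  \<open>c - x = y\<close> and \<open>c - y = x\<close> are the residues of the pairs themselves.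
  The pairs form a strong starter, and the triples occupy the 45 nonzero residues that are not
  sums.\<close>

lemma starter_91_91: "starter 91 91 (blocks_of
    [(4, 23, 64), (5, 26, 58), (6, 13, 15), (8, 79, 82), (9, 31, 86), (10, 75, 83), (11, 41, 53),
     (12, 45, 90), (17, 54, 69), (18, 52, 80), (19, 29, 85), (22, 46, 62), (25, 30, 36),
     (37, 38, 81), (44, 67, 71)]
    [(1, 33, 34), (2, 12, 14), (3, 36, 39), (4, 47, 51), (5, 87, 1), (6, 68, 74), (7, 77, 84),
     (8, 19, 27), (9, 51, 60), (10, 32, 42), (11, 50, 61), (13, 44, 57), (14, 34, 48),
     (15, 61, 76), (16, 73, 89), (17, 81, 7), (18, 55, 73), (20, 23, 43), (21, 49, 70),
     (22, 90, 21), (24, 64, 88), (25, 40, 65), (26, 67, 2), (27, 80, 16), (28, 83, 20),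
     (29, 43, 72), (30, 48, 78), (31, 37, 68), (35, 59, 3), (38, 39, 77), (41, 46, 87),
     (42, 89, 40), (45, 70, 24), (52, 71, 32), (53, 88, 50), (54, 84, 47), (56, 63, 28),
     (57, 69, 35), (58, 66, 33), (60, 86, 55), (62, 78, 49), (65, 82, 56), (72, 85, 66),
     (74, 76, 59), (75, 79, 63)])"
  by code_simp

text \<open>The unit 154 = -3 has order 39 modulo 157 and permutes the blocks. The pairs are the
  orbits of \<open>(1, 5, 154)\<close> and \<open>(3, 23, 65)\<close>; every triple is a coset of
  the subgroup {1, 12, 144}.\<close>

lemma starter_157_157: "starter 157 157 (blocks_of
    [(2, 24, 131), (3, 36, 118), (4, 48, 105), (5, 60, 92), (10, 27, 120), (13, 145, 156),
     (18, 59, 80), (21, 41, 95), (22, 28, 107), (25, 143, 146), (29, 34, 94), (31, 58, 68),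
     (32, 55, 70), (33, 42, 82), (38, 134, 142), (43, 45, 69), (44, 56, 57), (49, 117, 148),
     (51, 122, 141), (61, 104, 149), (64, 110, 140), (73, 91, 150), (74, 103, 137),
     (76, 111, 127), (78, 85, 151), (86, 90, 138)]
    [(1, 5, 154), (2, 126, 93), (3, 23, 65), (4, 83, 139), (6, 110, 133), (7, 76, 129),
     (8, 42, 125), (9, 45, 130), (10, 129, 112), (11, 55, 124), (12, 60, 121), (13, 152, 20),
     (14, 70, 115), (15, 118, 97), (16, 80, 109), (17, 85, 106), (18, 35, 52), (19, 95, 100),
     (20, 105, 77), (21, 67, 113), (22, 130, 81), (24, 99, 17), (25, 87, 123), (26, 58, 53),
     (27, 50, 114), (28, 37, 46), (29, 100, 14), (30, 150, 67), (31, 133, 96), (32, 132, 75),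
     (33, 96, 87), (34, 101, 11), (36, 119, 152), (38, 39, 40), (40, 43, 37), (41, 71, 101),
     (44, 128, 116), (46, 73, 19), (47, 78, 16), (48, 54, 98), (49, 114, 15), (51, 77, 6),
     (52, 103, 1), (53, 82, 102), (56, 63, 62), (57, 123, 136), (59, 106, 153), (61, 75, 89),
     (62, 90, 66), (64, 72, 26), (65, 145, 54), (66, 111, 50), (68, 155, 8), (69, 108, 147),
     (74, 109, 144), (79, 140, 155), (81, 91, 71), (84, 127, 135), (86, 136, 84), (88, 148, 119),
     (89, 131, 47), (92, 144, 39), (93, 151, 35), (94, 113, 132), (97, 156, 83), (98, 122, 79),
     (102, 143, 63), (104, 115, 126), (107, 147, 30), (112, 117, 23), (116, 138, 7),
     (120, 135, 88), (121, 134, 108), (124, 149, 99), (125, 146, 128), (137, 153, 12),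
     (139, 141, 72), (142, 154, 9)])"
  by code_simp

text \<open>The unit 64, of order 27 modulo 163, generates all blocks from the triple
  \<open>(4, 26, 123)\<close> and the pairs \<open>(1, 17, 36)\<close>, \<open>(2, 87, 154)\<close>
  and \<open>(3, 111, 139)\<close>.\<close>

lemma starter_163_163: "starter 163 163 (blocks_of
    [(4, 26, 123), (5, 81, 119), (8, 60, 97), (9, 39, 99), (10, 110, 152), (13, 15, 16),
     (14, 23, 91), (17, 46, 145), (24, 86, 156), (27, 121, 144), (28, 47, 95), (30, 62, 160),
     (31, 111, 151), (33, 37, 143), (34, 48, 93), (35, 43, 59), (41, 69, 125), (49, 74, 162),
     (51, 87, 142), (54, 71, 105), (55, 102, 113), (56, 127, 134), (57, 84, 138), (78, 90, 96),
     (83, 88, 98), (100, 141, 161), (118, 131, 157)]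
    [(1, 17, 36), (2, 87, 154), (3, 111, 139), (4, 75, 52), (5, 77, 1), (6, 102, 53),
     (7, 60, 50), (8, 58, 132), (9, 107, 89), (10, 137, 117), (11, 81, 75), (12, 33, 109),
     (13, 135, 133), (14, 18, 19), (15, 159, 32), (16, 154, 122), (19, 51, 11), (20, 88, 3),
     (21, 31, 104), (22, 48, 140), (23, 126, 135), (24, 124, 149), (25, 99, 85), (26, 128, 76),
     (27, 155, 38), (28, 40, 136), (29, 95, 94), (30, 136, 6), (32, 43, 70), (34, 42, 137),
     (35, 72, 2), (36, 123, 155), (37, 146, 40), (38, 157, 64), (39, 120, 18), (41, 89, 7),
     (44, 121, 128), (45, 83, 42), (46, 76, 147), (47, 106, 12), (49, 63, 148), (50, 56, 101),
     (52, 131, 73), (53, 86, 115), (54, 153, 45), (55, 94, 63), (57, 80, 129), (59, 61, 77),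
     (62, 67, 106), (64, 110, 22), (65, 127, 58), (66, 160, 124), (68, 71, 108), (69, 112, 82),
     (70, 145, 92), (73, 93, 68), (74, 101, 116), (78, 158, 146), (79, 152, 20), (82, 100, 159),
     (84, 108, 114), (85, 141, 126), (90, 139, 29), (91, 122, 103), (92, 144, 79), (96, 109, 80),
     (97, 148, 120), (98, 140, 150), (103, 161, 107), (104, 138, 158), (105, 150, 21),
     (113, 130, 67), (114, 143, 66), (115, 162, 65), (116, 156, 130), (117, 118, 44),
     (119, 147, 72), (125, 132, 25), (129, 151, 153), (133, 142, 61), (134, 149, 112)])"
  by code_simp

text \<open>An automorphism of order 3 acts on labels of points and classes alike: it fixes 0 to 5,
  adds 2 cyclically within 6 to 11 and within 18 to 23, and subtracts 2 cyclically within 12 to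
  17.\<close>

definition frame_6_4 :: "(int \<times> (int \<times> bool) list) list" where
  "frame_6_4 = concat (map (\<lambda>(c, bs). map (Pair c) bs)
    [(0, blocks_of [(6, 17, 19), (8, 15, 21), (10, 13, 23)]
      [(6, 19, 14), (7, 12, 18), (8, 21, 12), (9, 16, 20), (10, 23, 16), (11, 14, 22),
       (13, 22, 9), (15, 20, 7), (17, 18, 11)]),
     (1, blocks_of [(7, 16, 18), (9, 14, 20), (11, 12, 22)]
      [(6, 14, 23), (7, 21, 15), (8, 12, 19), (9, 23, 13), (10, 16, 21), (11, 19, 17),
       (13, 20, 8), (15, 18, 6), (17, 22, 10)]),
     (2, blocks_of [(6, 13, 21), (8, 17, 23), (10, 15, 19)]
      [(6, 17, 20), (7, 20, 14), (8, 15, 22), (9, 22, 12), (10, 13, 18), (11, 18, 16),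
       (12, 19, 7), (14, 23, 11), (16, 21, 9)]),
     (3, blocks_of [(7, 14, 21), (9, 12, 23), (11, 16, 19)]
      [(6, 13, 22), (7, 22, 17), (8, 17, 18), (9, 18, 15), (10, 15, 20), (11, 20, 13),
       (12, 21, 10), (14, 19, 8), (16, 23, 6)]),
     (4, blocks_of [(6, 12, 20), (8, 16, 22), (10, 14, 18)]
      [(6, 18, 17), (7, 16, 23), (8, 20, 15), (9, 14, 19), (10, 22, 13), (11, 12, 21),
       (13, 19, 11), (15, 23, 9), (17, 21, 7)]),
     (5, blocks_of [(7, 15, 22), (9, 13, 18), (11, 17, 20)]
      [(6, 23, 12), (7, 17, 21), (8, 19, 16), (9, 15, 23), (10, 21, 14), (11, 13, 19),
       (12, 22, 8), (14, 20, 6), (16, 18, 10)]),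
     (6, blocks_of [(2, 16, 21), (3, 13, 19), (5, 12, 18)]
      [(0, 22, 15), (1, 18, 14), (2, 14, 20), (3, 16, 22), (4, 21, 17), (5, 12, 23), (13, 23, 1),
       (15, 19, 0), (17, 20, 4)]),
     (7, blocks_of [(0, 15, 18), (1, 13, 22), (4, 14, 19)]
      [(0, 19, 12), (1, 23, 17), (2, 17, 23), (3, 20, 16), (4, 15, 21), (5, 13, 20), (12, 18, 2),
       (14, 21, 3), (16, 22, 5)]),
     (8, blocks_of [(2, 14, 23), (3, 17, 21), (5, 16, 20)]
      [(0, 18, 13), (1, 20, 12), (2, 12, 22), (3, 14, 18), (4, 23, 15), (5, 16, 19), (13, 21, 0),
       (15, 22, 4), (17, 19, 1)]),
     (9, blocks_of [(0, 13, 20), (1, 17, 18), (4, 12, 21)]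
      [(0, 21, 16), (1, 19, 15), (2, 15, 19), (3, 22, 14), (4, 13, 23), (5, 17, 22), (12, 23, 3),
       (14, 18, 5), (16, 20, 2)]),
     (10, blocks_of [(2, 12, 19), (3, 15, 23), (5, 14, 22)]
      [(0, 20, 17), (1, 22, 16), (2, 16, 18), (3, 12, 20), (4, 19, 13), (5, 14, 21), (13, 18, 4),
       (15, 21, 1), (17, 23, 0)]),
     (11, blocks_of [(0, 17, 22), (1, 15, 20), (4, 16, 23)]
      [(0, 23, 14), (1, 21, 13), (2, 13, 21), (3, 18, 12), (4, 17, 19), (5, 15, 18), (12, 20, 5),
       (14, 22, 2), (16, 19, 3)]),
     (12, blocks_of [(1, 10, 21), (2, 8, 20), (5, 7, 23)]
      [(0, 6, 19), (1, 9, 18), (2, 20, 9), (3, 21, 11), (4, 10, 22), (5, 19, 6), (7, 23, 4),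
       (8, 18, 3), (11, 22, 0)]),
     (13, blocks_of [(0, 9, 21), (3, 11, 18), (4, 10, 20)]
      [(0, 9, 22), (1, 8, 23), (2, 21, 6), (3, 7, 19), (4, 18, 8), (5, 22, 7), (6, 20, 1),
       (10, 19, 2), (11, 23, 5)]),
     (14, blocks_of [(1, 8, 19), (2, 6, 18), (5, 11, 21)]
      [(0, 10, 23), (1, 7, 22), (2, 18, 7), (3, 19, 9), (4, 8, 20), (5, 23, 10), (6, 22, 3),
       (9, 20, 0), (11, 21, 4)]),
     (15, blocks_of [(0, 7, 19), (3, 9, 22), (4, 8, 18)]
      [(0, 7, 20), (1, 6, 21), (2, 19, 10), (3, 11, 23), (4, 22, 6), (5, 20, 11), (8, 23, 2),
       (9, 21, 5), (10, 18, 1)]),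
     (16, blocks_of [(1, 6, 23), (2, 10, 22), (5, 9, 19)]
      [(0, 8, 21), (1, 11, 20), (2, 22, 11), (3, 23, 7), (4, 6, 18), (5, 21, 8), (7, 18, 0),
       (9, 19, 4), (10, 20, 3)]),
     (17, blocks_of [(0, 11, 23), (3, 7, 20), (4, 6, 22)]
      [(0, 11, 18), (1, 10, 19), (2, 23, 8), (3, 9, 21), (4, 20, 10), (5, 18, 9), (6, 21, 2),
       (7, 19, 5), (8, 22, 1)]),
     (18, blocks_of [(3, 6, 14), (4, 11, 15), (5, 8, 13)]
      [(0, 15, 10), (1, 13, 7), (2, 7, 16), (3, 8, 17), (4, 14, 9), (5, 10, 12), (6, 12, 0),
       (9, 17, 2), (11, 16, 1)]),
     (19, blocks_of [(0, 6, 16), (1, 11, 14), (2, 7, 17)]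
      [(0, 12, 9), (1, 14, 10), (2, 8, 13), (3, 15, 8), (4, 7, 12), (5, 11, 15), (6, 16, 4),
       (9, 13, 3), (10, 17, 5)]),
     (20, blocks_of [(3, 8, 12), (4, 7, 13), (5, 10, 17)]
      [(0, 13, 6), (1, 17, 9), (2, 9, 14), (3, 10, 15), (4, 12, 11), (5, 6, 16), (7, 14, 1),
       (8, 16, 0), (11, 15, 2)]),
     (21, blocks_of [(0, 8, 14), (1, 7, 12), (2, 9, 15)]
      [(0, 16, 11), (1, 12, 6), (2, 10, 17), (3, 13, 10), (4, 9, 16), (5, 7, 13), (6, 15, 5),
       (8, 14, 4), (11, 17, 3)]),
     (22, blocks_of [(3, 10, 16), (4, 9, 17), (5, 6, 15)]
      [(0, 17, 8), (1, 15, 11), (2, 11, 12), (3, 6, 13), (4, 16, 7), (5, 8, 14), (7, 13, 2),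
       (9, 12, 1), (10, 14, 0)]),
     (23, blocks_of [(0, 10, 12), (1, 9, 16), (2, 11, 13)]
      [(0, 14, 7), (1, 16, 8), (2, 6, 15), (3, 17, 6), (4, 11, 14), (5, 9, 17), (7, 15, 3),
       (8, 13, 5), (10, 12, 4)])])"

lemma frame_list_6_4: "frame_list 24 6 frame_6_4"
  by code_simp

section \<open>From frames to Kirkman triple systems\<close>

text \<open>Over a complete graph, class \<open>c\<close> covers every point except
  \<open>(c, True)\<close> and \<open>(c, False)\<close>. These two and the restored point form the
  block \<open>I c\<close>, which completes the class to a partition of \<open>V\<close>.\<close>

lemma ex_MK_if_complete_framed:
  assumes "complete_framed u"
  shows "\<exists>(V :: nat set) \<B>. MK u V \<B>"
proof -
  define X where "X = {0..<int u}"
  obtain F where F: "frame (multipartite X id) F"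
    using assms unfolding complete_framed_def framed_def X_def by blast
  \<comment> \<open>\<open>Suc\<close> keeps 0 free for the restored point.\<close>
  define \<psi> where "\<psi> p = Suc (to_nat (p :: int \<times> bool))" for p
  have inj: "inj \<psi>" by (rule injI) (simp add: \<psi>_def)
  have z [simp]: "\<psi> p \<noteq> 0" "0 \<noteq> \<psi> p" for p by (simp_all add: \<psi>_def)
  have z_img [simp]: "0 \<notin> \<psi> ` B" for B by (auto simp: \<psi>_def)
  have mem [simp]: "\<psi> p \<in> \<psi> ` B \<longleftrightarrow> p \<in> B" for p B using inj by (simp add: inj_image_mem_iff)
  have \<psi>_eq [simp]: "\<psi> p = \<psi> q \<longleftrightarrow> p = q" for p q using inj by (auto dest: injD)
  have img_eq [simp]: "\<psi> ` A = \<psi> ` B \<longleftrightarrow> A = B" for A B using inj by (simp add: inj_image_eq_iff)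
  have D: "(x, y) \<in> multipartite X id \<longleftrightarrow> x \<in> X \<and> y \<in> X \<and> x \<noteq> y" for x y
    by (auto simp: multipartite_def)
  have card3: "card B = 3" if "(c, B) \<in> F" for c B using frame_card[OF F that] .
  have pt: "c \<in> X" "fst p \<in> X" "fst p \<noteq> c" if "(c, B) \<in> F" "p \<in> B" for c B p
    using frame_class_in[OF F that] by (auto simp: D)
  have pair: "fst p \<noteq> fst q" if "(c, B) \<in> F" "p \<in> B" "q \<in> B" "p \<noteq> q" for c B p q
    using frame_pair_in[OF F that] by (auto simp: D)
  have cX: "c \<in> X" if "(c, B) \<in> F" for c B
  proof -
    have "B \<noteq> {}" using card3[OF that] by auto
    then show ?thesis using pt(1)[OF that] by blast
  qed
  define V where "V = insert 0 (\<psi> ` (X \<times> UNIV))"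
  define I where "I c = {0, \<psi> (c, True), \<psi> (c, False)}" for c
  define P where "P c = insert (I c) ((`) \<psi> ` {B. (c, B) \<in> F})" for c
  define \<B> where "\<B> = (\<Union>c\<in>X. P c)"
  define U where "U = \<psi> ` (X \<times> {True})"
  define \<A> where "\<A> = {\<psi> ` B |c B. (c, B) \<in> F \<and> B \<subseteq> X \<times> {True}}"
  have B_iff: "K \<in> \<B> \<longleftrightarrow> (\<exists>c\<in>X. K = I c) \<or> (\<exists>c B. (c, B) \<in> F \<and> K = \<psi> ` B)" for K
    unfolding \<B>_def P_def using cX by blast
  have I_mem [simp]: "\<psi> p \<in> I c \<longleftrightarrow> fst p = c" for p c
    by (cases p; cases "snd p") (auto simp: I_def)
  have I_0 [simp]: "0 \<in> I c" for c by (simp add: I_def)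
  have I_card: "card (I c) = 3" for c by (simp add: I_def)
  have img_card: "card (\<psi> ` B) = card B" for B using inj by (simp add: card_image inj_on_subset)
  have I_eq: "I c = I c' \<longleftrightarrow> c = c'" for c c'
  proof
    assume "I c = I c'"
    then have "\<psi> (c, True) \<in> I c'" by (simp flip: \<open>I c = I c'\<close>)
    then show "c = c'" by simp
  qed simp
  have card_V: "card V = 2 * u + 1"
    by (simp add: V_def img_card X_def card_cartesian_product)
  have sub_V: "\<psi> ` B \<subseteq> V" if "(c, B) \<in> F" for c B
    using pt(2)[OF that] by (force simp: V_def)
  have I_V: "I c \<subseteq> V" if "c \<in> X" for c using that by (auto simp: I_def V_def)
  have point_ex1: "\<exists>!K. K \<in> \<B> \<and> 0 \<in> K \<and> \<psi> p \<in> K" if "fst p \<in> X" for p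
    by (rule ex1I[of _ "I (fst p)"]) (use that in \<open>auto simp: B_iff\<close>)
  have pair_ex1: "\<exists>!K. K \<in> \<B> \<and> \<psi> p \<in> K \<and> \<psi> q \<in> K" if "fst p \<in> X" "fst q \<in> X" "p \<noteq> q" for p q
  proof (cases "fst p = fst q")
    case True
    show ?thesis
    proof (rule ex1I[of _ "I (fst p)"])
      fix K assume K: "K \<in> \<B> \<and> \<psi> p \<in> K \<and> \<psi> q \<in> K"
      then consider c where "K = I c" | c B where "(c, B) \<in> F" "K = \<psi> ` B" unfolding B_iff by blast
      then show "K = I (fst p)"
      proof cases
        case 1
        then show ?thesis using K by simp
      next
        case 2
        then show ?thesis using pair[OF 2(1), of p q] K that True by simp
      qed
    qed (use that True in \<open>auto simp: B_iff\<close>)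
  next
    case False
    then have "(fst p, fst q) \<in> multipartite X id" using that by (simp add: D)
    from frame_pair_ex1[OF F this, of "snd p" "snd q"]
    obtain e where e0: "e \<in> F \<and> (fst p, snd p) \<in> snd e \<and> (fst q, snd q) \<in> snd e"
      and uni: "\<forall>e'. e' \<in> F \<and> (fst p, snd p) \<in> snd e' \<and> (fst q, snd q) \<in> snd e' \<longrightarrow> e' = e"
      by (rule ex1E)
    then have e: "e \<in> F" "p \<in> snd e" "q \<in> snd e" by simp_all
    show ?thesis
    proof (rule ex1I[of _ "\<psi> ` snd e"])
      show "\<psi> ` snd e \<in> \<B> \<and> \<psi> p \<in> \<psi> ` snd e \<and> \<psi> q \<in> \<psi> ` snd e"
        using e by (cases e) (auto simp: B_iff)
      fix K assume K: "K \<in> \<B> \<and> \<psi> p \<in> K \<and> \<psi> q \<in> K"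
      then consider c where "K = I c" | c B where "(c, B) \<in> F" "K = \<psi> ` B" unfolding B_iff by blast
      then show "K = \<psi> ` snd e"
      proof cases
        case 1
        then show ?thesis using K False by simp
      next
        case 2
        then have "(c, B) = e" using K by (intro uni[rule_format]) simp
        then show ?thesis using 2 by auto
      qed
    qed
  qed
  have sts_V: "steiner_triple_system (2 * u + 1) V \<B>"
    unfolding steiner_triple_system_def
  proof (intro conjI ballI impI)
    show "finite V" "card V = 2 * u + 1" using card_V by (auto simp: V_def X_def)
    fix K assume "K \<in> \<B>"
    then consider c where "c \<in> X" "K = I c" | c B where "(c, B) \<in> F" "K = \<psi> ` B"
      unfolding B_iff by blast
    then show "K \<subseteq> V" "card K = 3"
      by (cases; simp add: I_V sub_V I_card card3 img_card)+
  next
    fix x y assume xy: "x \<in> V" "y \<in> V" "x \<noteq> y"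
    then consider p where "x = 0" "y = \<psi> p" "fst p \<in> X" | p where "x = \<psi> p" "y = 0" "fst p \<in> X"
      | p q where "x = \<psi> p" "y = \<psi> q" "fst p \<in> X" "fst q \<in> X" "p \<noteq> q"
      unfolding V_def by auto
    then show "\<exists>!K. K \<in> \<B> \<and> x \<in> K \<and> y \<in> K"
    proof cases
      case 1
      then show ?thesis using point_ex1 by simp
    next
      case 2
      then show ?thesis using point_ex1[of p] by (simp add: conj_commute)
    next
      case 3
      then show ?thesis using pair_ex1 by simp
    qed
  qed
  have part_V: "partition_on V (P c)" if c: "c \<in> X" for c
  proof (rule partition_onI)
    have cls: "\<exists>!B. (c, B) \<in> F \<and> p \<in> B" if "fst p \<in> X" "fst p \<noteq> c" for p
      using frame_class_ex1[OF F, of c "fst p" "snd p"] that c by (simp add: D)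
    show "\<Union> (P c) = V"
    proof
      show "\<Union> (P c) \<subseteq> V" using I_V[OF c] sub_V[of c] unfolding P_def by blast
      show "V \<subseteq> \<Union> (P c)"
      proof
        fix x assume "x \<in> V"
        then consider "x \<in> I c" | p where "x = \<psi> p" "fst p \<in> X" "fst p \<noteq> c"
          unfolding V_def by force
        then show "x \<in> \<Union> (P c)"
        proof cases
          case 2
          then obtain B where "(c, B) \<in> F" "p \<in> B" using cls by blast
          then show ?thesis using 2 by (auto simp: P_def)
        qed (simp add: P_def)
      qed
    qed
    have IB: "I c \<inter> \<psi> ` B = {}" if "(c, B) \<in> F" for B
      using pt(3)[OF that] by (force simp: I_def)
    have BB: "\<psi> ` B \<inter> \<psi> ` B' = {}" if "(c, B) \<in> F" "(c, B') \<in> F" "B \<noteq> B'" for B B'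
    proof (rule ccontr)
      assume "\<psi> ` B \<inter> \<psi> ` B' \<noteq> {}"
      then obtain p where "p \<in> B" "p \<in> B'" by auto
      then show False using cls[of p] that pt(2,3)[OF that(1)] by blast
    qed
    show "disjnt K K'" if "K \<in> P c" "K' \<in> P c" "K \<noteq> K'" for K K'
      using that IB BB unfolding P_def disjnt_def by blast
    show "{} \<notin> P c" using card3 by (force simp: P_def I_def)
  qed
  have part_B: "partition_on \<B> (P ` X)"
  proof (rule partition_onI)
    show "\<Union> (P ` X) = \<B>" by (simp add: \<B>_def)
    show "{} \<notin> P ` X" by (auto simp: P_def)
    fix Q Q' assume Q: "Q \<in> P ` X" "Q' \<in> P ` X" "Q \<noteq> Q'"
    then obtain c c' where c: "Q = P c" "Q' = P c'" "c \<noteq> c'" by blast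
    \<comment> \<open>Uniqueness in a frame concerns the block together with its class label, so two
      points of a block already determine its class; no block lies in two classes.\<close>
    have "c = c'" if cB: "(c, B) \<in> F" "(c', B) \<in> F" for B
    proof -
      obtain p q where pq: "p \<in> B" "q \<in> B" "p \<noteq> q"
        using card3[OF cB(1)] by (auto simp: card_3_iff)
      have "(fst p, fst q) \<in> multipartite X id" using frame_pair_in[OF F cB(1) pq] .
      from frame_pair_ex1[OF F this, of "snd p" "snd q"]
      obtain e where "\<forall>e'. e' \<in> F \<and> (fst p, snd p) \<in> snd e' \<and> (fst q, snd q) \<in> snd e' \<longrightarrow> e' = e"
        by (rule ex1E)
      with cB pq have "(c, B) = e" "(c', B) = e" by (metis prod.collapse snd_conv)+
      then show ?thesis by blast
    qed
    moreover have "I c0 \<noteq> \<psi> ` B" for c0 B using I_0[of c0] by (metis z_img)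
    ultimately show "disjnt Q Q'" using c I_eq by (auto simp: P_def disjnt_def)
  qed
  have sts_U: "steiner_triple_system u U \<A>"
    unfolding steiner_triple_system_def
  proof (intro conjI ballI impI)
    show "finite U" "card U = u"
      by (simp_all add: U_def img_card X_def card_cartesian_product)
    fix K assume "K \<in> \<A>"
    then obtain c B where "(c, B) \<in> F" "B \<subseteq> X \<times> {True}" "K = \<psi> ` B" unfolding \<A>_def by blast
    then show "K \<subseteq> U" "card K = 3" by (simp_all add: U_def image_mono card3 img_card)
  next
    fix x y assume xy: "x \<in> U" "y \<in> U" "x \<noteq> y"
    then obtain a b where ab: "x = \<psi> (a, True)" "y = \<psi> (b, True)" "a \<in> X" "b \<in> X" "a \<noteq> b"
      by (auto simp: U_def)
    then have "(a, b) \<in> multipartite X id" by (simp add: D)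
    from ex1_implies_ex[OF frame_pair_ex1[OF F this, of True True]] obtain c B where
      B: "(c, B) \<in> F" "(a, True) \<in> B" "(b, True) \<in> B" by auto
    \<comment> \<open>The closure condition of a frame: the block through two points of
      \<open>U\<close> stays inside \<open>U\<close>, so it is also a block of the
      subdesign.\<close>
    have "snd r" if "r \<in> B" for r
      using frame_closed[OF F B(1) B(2,3) that] ab(5) by simp
    then have "B \<subseteq> X \<times> {True}" using pt(2)[OF B(1)] by (auto simp: mem_Times_iff)
    then have "\<psi> ` B \<in> \<A>" using B by (auto simp: \<A>_def)
    moreover have "\<A> \<subseteq> \<B>" by (auto simp: \<A>_def B_iff)
    moreover have "\<exists>!K. K \<in> \<B> \<and> x \<in> K \<and> y \<in> K" using pair_ex1[of "(a, True)" "(b, True)"] ab by simp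
    moreover have "x \<in> \<psi> ` B" "y \<in> \<psi> ` B" using B ab by simp_all
    ultimately show "\<exists>!K. K \<in> \<A> \<and> x \<in> K \<and> y \<in> K" by blast
  qed
  have "U \<subseteq> V" by (auto simp: U_def V_def)
  moreover have "\<A> \<subseteq> \<B>" by (auto simp: \<A>_def B_iff)
  ultimately have "subdesign u U \<A> V \<B>" using sts_U by (simp add: subdesign_def)
  then have "MK u V \<B>"
    unfolding MK_def kirkman_triple_system_def using sts_V part_B part_V by blast
  then show ?thesis by blast
qed

section \<open>Base cases and the recursion on k\<close>

lemma complete_framed_if_starter:
  assumes "starter n n bs"
  shows "complete_framed (nat n)"
proof -
  have "0 \<le> n" using assms by (simp add: starter_def)
  moreover have "multipartite {0..<n} (\<lambda>x. x mod n) = multipartite {0..<n} id"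
    by (auto simp: multipartite_def)
  ultimately show ?thesis
    using framed_if_starter[OF assms] by (simp add: complete_framed_def)
qed

lemma complete_framed_small:
  assumes "k \<le> 15 \<or> k = 26 \<or> k = 27"
  shows "complete_framed (6 * k + 1)"
proof -
  \<comment> \<open>The case \<open>k = 0\<close>: one label and no edges; it yields a single block
    whose subdesign is one point.\<close>
  have "multipartite {0..<1 :: int} id = {}" by (auto simp: multipartite_def)
  moreover have "frame {} {}" by (simp add: frame_def irrefl_def)
  ultimately have one: "complete_framed 1"
    by (auto simp: complete_framed_def framed_def)
  note starters = starter_7_7 starter_13_13 starter_19_19 starter_25_25 starter_31_31 starter_37_37
    starter_43_43 starter_49_49 starter_55_55 starter_61_61 starter_67_67 starter_73_73
    starter_79_79 starter_85_85 starter_91_91 starter_157_157 starter_163_163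
  note cases = one starters[THEN complete_framed_if_starter, simplified]
  have "k = 0 \<or> k = 1 \<or> k = 2 \<or> k = 3 \<or> k = 4 \<or> k = 5 \<or> k = 6 \<or> k = 7 \<or> k = 8 \<or> k = 9
      \<or> k = 10 \<or> k = 11 \<or> k = 12 \<or> k = 13 \<or> k = 14 \<or> k = 15 \<or> k = 26 \<or> k = 27"
    using assms by presburger
  then show ?thesis using cases by (elim disjE) simp_all
qed

lemma framed_6_4: "framed (multipartite {0..<24 :: int} (\<lambda>x. x div 6))"
  by (rule framed_if_frame_list[OF frame_list_6_4])

lemma framed_6_5: "framed (multipartite {0..<30 :: int} (\<lambda>x. x div 6))"
proof (rule framed_image[OF framed_if_starter[OF starter_30_5]])
  \<comment> \<open>Carries the residue class r modulo 5 to the interval from 6r to 6r + 5,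
    exchanging cosets for intervals as groups.\<close>
  let ?f = "\<lambda>x :: int. 6 * (x mod 5) + x div 5"
  have div: "?f x div 6 = x mod 5" and rem: "?f x mod 6 = x div 5" if "x \<in> {0..<30}" for x
    using that by auto
  have inj: "inj_on ?f {0..<30}"
  proof (rule inj_onI)
    fix x y :: int assume "x \<in> {0..<30}" "y \<in> {0..<30}" "?f x = ?f y"
    then have "x mod 5 = y mod 5" "x div 5 = y div 5" using div rem by metis+
    then show "x = y" by (metis div_mult_mod_eq)
  qed
  moreover have "?f ` {0..<30} \<subseteq> {0..<30}" by auto
  ultimately show "bij_betw ?f {0..<30} {0..<30}"
    by (simp add: bij_betw_def endo_inj_surj)
  show "x mod 5 = y mod 5 \<longleftrightarrow> ?f x div 6 = ?f y div 6" if "x \<in> {0..<30}" "y \<in> {0..<30}" for x y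
    using div that by simp
qed

text \<open>Let m be the largest number coprime to 6 with 4m <= k. The next such number is at most m
  + 4, so k <= 4m + 15, and this is at most 5m once m >= 15. For k >= 72 one even has m >=
  17.\<close>

lemma ex_coprime_6_between:
  assumes "72 \<le> k"
  shows "\<exists>m. (m mod 6 = 1 \<or> m mod 6 = 5) \<and> 4 * m \<le> k \<and> k \<le> 5 * (m :: nat)"
proof -
  define q where "q = k div 24 - 1"
  define w where "w = k mod 24"
  have k: "k = 24 * (q + 1) + w" "w < 24" "2 \<le> q"
    using assms by (auto simp: q_def w_def)
  \<comment> \<open>The cuts are where \<open>4 * m\<close> passes \<open>k\<close> for m = 6q + 7
    and m = 6q + 11. The bound \<open>2 <= q\<close> enters at w = 19, where 30q + 35 has to reach
    24q + 43.\<close>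
  consider "w < 4" | "4 \<le> w" "w < 20" | "20 \<le> w" by linarith
  then show ?thesis
  proof cases
    case 1
    have "(6 * q + 5) mod 6 = 5" by presburger
    then show ?thesis using 1 k by (intro exI[of _ "6 * q + 5"]) auto
  next
    case 2
    have "(6 * q + 7) mod 6 = 1" by presburger
    then show ?thesis using 2 k by (intro exI[of _ "6 * q + 7"]) auto
  next
    case 3
    have "(6 * q + 11) mod 6 = 5" by presburger
    then show ?thesis using 3 k by (intro exI[of _ "6 * q + 11"]) auto
  qed
qed

lemma complete_framed_step:
  assumes IH: "\<And>j. j < k \<Longrightarrow> complete_framed (6 * j + 1)"
    and td: "transversal_design 5 L T v" "finite L" "card L = m"
    and m: "0 < m" "4 * m \<le> k" "k \<le> 5 * m"
  shows "complete_framed (6 * k + 1)"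
proof -
  \<comment> \<open>The truncated group keeps t = k - 4m points. Since \<open>m\<close> is positive,
    both \<open>m\<close> and t are below \<open>k\<close>, so the induction hypothesis covers the
    two complete graphs.\<close>
  have "complete_framed (6 * (4 * m + (k - 4 * m)) + 1)"
    using m by (intro complete_framed_transversal[OF td] IH framed_6_4 framed_6_5) auto
  then show ?thesis using m by simp
qed

lemma complete_framed_1_mod_6: "complete_framed (6 * k + 1)"
proof (induction k rule: less_induct)
  case (less k)
  note step = complete_framed_step[OF less.IH]
  have coprime_case: ?case if m: "m mod 6 = 1 \<or> m mod 6 = 5" "4 * m \<le> k" "k \<le> 5 * m" for m
  proof -
    have "0 < m" using m(1) by (cases "m = 0") auto
    moreover have "coprime (int m) 6"
    proof -
      have "int m mod 6 = 1 \<or> int m mod 6 = 5" using m(1) by presburger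
      moreover have "coprime (1 :: int) 6" "coprime (5 :: int) 6" by code_simp+
      ultimately show ?thesis by (metis coprime_mod_left_iff zero_neq_numeral)
    qed
    ultimately show ?thesis
      using m by (intro step[OF _ transversal_design_coprime_6[of "int m"]]) auto
  qed
  \<comment> \<open>Besides 26 and 27, orders m coprime to 6 leave the gaps 16 to 19, 36 to 43 and
    66 to 67, which m = 4, 9 and 16 fill.\<close>
  consider "k \<le> 15 \<or> k = 26 \<or> k = 27" | "16 \<le> k" "k \<le> 19" | "20 \<le> k" "k \<le> 25" | "28 \<le> k" "k \<le> 35"
    | "36 \<le> k" "k \<le> 43" | "44 \<le> k" "k \<le> 55" | "56 \<le> k" "k \<le> 65" | "66 \<le> k" "k \<le> 71" | "72 \<le> k"
    by linarith
  then show ?case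
  proof cases
    case 1
    then show ?thesis by (rule complete_framed_small)
  next
    case 2
    then show ?thesis by (intro step[OF _ transversal_design_4, where m = 4]) auto
  next
    case 3
    then show ?thesis by (intro coprime_case[of 5]) auto
  next
    case 4
    then show ?thesis by (intro coprime_case[of 7]) auto
  next
    case 5
    then show ?thesis by (intro step[OF _ transversal_design_9, where m = 9]) auto
  next
    case 6
    then show ?thesis by (intro coprime_case[of 11]) auto
  next
    case 7
    then show ?thesis by (intro coprime_case[of 13]) auto
  next
    case 8
    then show ?thesis
      by (intro step[OF _ transversal_design_prod[OF transversal_design_4 transversal_design_4], where m = 16]) auto
  next
    case 9
    then show ?thesis using ex_coprime_6_between coprime_case by blast
  qed
qed

theorem theorem1p1:
  fixes u :: nat
  assumes "[u = 1] (mod 6)"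
  shows "\<exists>(V :: nat set) \<B>. MK u V \<B>"
proof -
  have "u mod 6 = 1" using assms by (simp add: cong_def)
  then have "u = 6 * (u div 6) + 1" by presburger
  then show ?thesis using ex_MK_if_complete_framed complete_framed_1_mod_6 by metis
qed

end
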